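(* Let $X=(X_1,X_2)$ be a two-dimensional Lévy process for which there exist $\gamma_1,\gamma_2>0$ such that $\kappa(-\gamma_1,0)=\kappa(0,-\gamma_2)=0$ and $(-\gamma_1,0),(0,-\gamma_2)\in\Xi^o$, and let $a>0$. Then as $K\to\infty$, $$\psi_{\mathrm{or}}(aK,K)\sim C_2e^{-\gamma_2K}+C_1e^{-\gamma_1aK},$$ $$\psi_{\mathrm{and}}(aK,K)=o\big(C_2e^{-\gamma_2K}+C_1e^{-\gamma_1aK}\big),$$ where $C_i>0$, $i=1,2$, are the asymptotic constants corresponding to $X_i$.
   Context: $X=(X_1,X_2)$ is a general two-dimensional Lévy process started from $x=(x_1,x_2)$, i.e. $X(t)=x+Z(t)$ with $Z$ a fixed two-dimensional Lévy process started at $0$; in $\psi_{\cdot}(aK,K)$ the starting point is $(x_1,x_2)=(aK,K)$. The cases that $X_1$ or $X_2$ has monotone paths, or that the ratio $[X_1-x_1]/[X_2-x_2]$ is constant, are excluded, and $X_i(t)\to\infty$ a.s. The joint cumulant exponent is $\kappa(\theta_1,\theta_2)=\log E[e^{\theta_1(X_1(1)-x_1)+\theta_2(X_2(1)-x_2)}]$, $\Xi=\{\theta\in\mathbb R^2:\kappa(\theta)<\infty\}$, with interior $\Xi^o$. Write $\tau_i(x_i)=\inf\{t\ge0:X_i(t)<0\}$ and $\psi_i(x_i)=P(\tau_i(x_i)<\infty)$. Then $\psi_{\mathrm{or}}(x_1,x_2)=P(\exists\,t\ge0:X_1(t)<0\text{ or }X_2(t)<0)$ and $\psi_{\mathrm{and}}(x_1,x_2)=P(\tau_1(x_1)<\infty\text{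 and }\tau_2(x_2)<\infty)$. The asymptotic constant $C_i$ is the Cramér–Lundberg constant $C_i=\lim_{x\to\infty}e^{\gamma_ix}\psi_i(x)$. Here $f\sim h$ means $f/h\to1$ and $f=o(h)$ means $f/h\to0$. *)

theory Defs
  imports "HOL-Probability.Probability" "HOL-Library.Landau_Symbols"
begin

(* Cadlag paths are required for every outcome, not just almost surely, so that the ruin events
   below lie in sets M without completing M (measure M is 0 on non-measurable sets).
   Continuity in probability follows from right-continuity and stationarity. *)
definition cadlag :: "(real \<Rightarrow> 'b::topological_space) \<Rightarrow> bool" where
  "cadlag f \<longleftrightarrow> (\<forall>t\<ge>0. (f \<longlongrightarrow> f t) (at_right t)) \<and> (\<forall>t>0. \<exists>l. (f \<longlongrightarrow> l) (at_left t))"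

definition levy_process ::
  "'a measure \<Rightarrow> (real \<Rightarrow> 'a \<Rightarrow> 'b::euclidean_space) \<Rightarrow> bool" where
  "levy_process M Z \<longleftrightarrow>
     prob_space M \<and>
     (\<forall>t\<ge>0. Z t \<in> borel_measurable M) \<and>
     (AE \<omega> in M. Z 0 \<omega> = 0) \<and>
     (\<forall>n (t :: nat \<Rightarrow> real). 0 \<le> t 0 \<and> (\<forall>i<n. t i \<le> t (Suc i)) \<longrightarrow>
        prob_space.indep_vars M (\<lambda>_. borel) (\<lambda>i \<omega>. Z (t (Suc i)) \<omega> - Z (t i) \<omega>) {..<n}) \<and>
     (\<forall>s\<ge>0. \<forall>t\<ge>0. distr M borel (\<lambda>\<omega>. Z (s + t) \<omega> - Z s \<omega>) = distr M borel (Z t)) \<and>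
     (\<forall>\<omega>\<in>space M. cadlag (\<lambda>t. Z t \<omega>))"

definition has_monotone_paths :: "'a measure \<Rightarrow> (real \<Rightarrow> 'a \<Rightarrow> real) \<Rightarrow> bool" where
  "has_monotone_paths M Y \<longleftrightarrow>
     (AE \<omega> in M. mono_on {0..} (\<lambda>t. Y t \<omega>)) \<or> (AE \<omega> in M. antimono_on {0..} (\<lambda>t. Y t \<omega>))"

(* "The ratio of Y1 and Y2 is constant", written without division: Y2 vanishes at time 0. *)
definition has_constant_ratio ::
  "'a measure \<Rightarrow> (real \<Rightarrow> 'a \<Rightarrow> real) \<Rightarrow> (real \<Rightarrow> 'a \<Rightarrow> real) \<Rightarrow> bool" where
  "has_constant_ratio M Y1 Y2 \<longleftrightarrow> (\<exists>c. AE \<omega> in M. \<forall>t\<ge>0. Y1 t \<omega> = c * Y2 t \<omega>)"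

(* Extended-real valued; the expectation is never 0, so infinity is the only special case. *)
definition cumulant ::
  "'a measure \<Rightarrow> (real \<Rightarrow> 'a \<Rightarrow> real \<times> real) \<Rightarrow> real \<times> real \<Rightarrow> ereal" where
  "cumulant M Z \<theta> =
     (let m = (\<integral>\<^sup>+ \<omega>. ennreal (exp (fst \<theta> * fst (Z 1 \<omega>) + snd \<theta> * snd (Z 1 \<omega>))) \<partial>M)
      in if m = \<infinity> then \<infinity> else ereal (ln (enn2real m)))"

definition cumulant_domain ::
  "'a measure \<Rightarrow> (real \<Rightarrow> 'a \<Rightarrow> real \<times> real) \<Rightarrow> (real \<times> real) set" where
  "cumulant_domain M Z = {\<theta>. cumulant M Z \<theta> < \<infinity>}"

(* In the following definitions Y and Z start at 0; the process itself is x + Y, resp. x + Z. *)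
definition ruin_time :: "(real \<Rightarrow> 'a \<Rightarrow> real) \<Rightarrow> real \<Rightarrow> 'a \<Rightarrow> ereal" where
  "ruin_time Y x \<omega> = Inf {ereal t | t. 0 \<le> t \<and> x + Y t \<omega> < 0}"

definition ruin_prob :: "'a measure \<Rightarrow> (real \<Rightarrow> 'a \<Rightarrow> real) \<Rightarrow> real \<Rightarrow> real" where
  "ruin_prob M Y x = measure M {\<omega> \<in> space M. ruin_time Y x \<omega> < \<infinity>}"

definition ruin_prob_or ::
  "'a measure \<Rightarrow> (real \<Rightarrow> 'a \<Rightarrow> real \<times> real) \<Rightarrow> real \<Rightarrow> real \<Rightarrow> real" where
  "ruin_prob_or M Z x1 x2 =
     measure M {\<omega> \<in> space M. \<exists>t\<ge>0. x1 + fst (Z t \<omega>) < 0 \<or> x2 + snd (Z t \<omega>) < 0}"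

definition ruin_prob_and ::
  "'a measure \<Rightarrow> (real \<Rightarrow> 'a \<Rightarrow> real \<times> real) \<Rightarrow> real \<Rightarrow> real \<Rightarrow> real" where
  "ruin_prob_and M Z x1 x2 =
     measure M {\<omega> \<in> space M. ruin_time (\<lambda>t \<omega>. fst (Z t \<omega>)) x1 \<omega> < \<infinity> \<and>
                             ruin_time (\<lambda>t \<omega>. snd (Z t \<omega>)) x2 \<omega> < \<infinity>}"

end

theory Submission
  imports Defs
begin

text \<open>
  By inclusion and exclusion the probability of \<open>or\<close> is the sum of the two marginal ruin
  probabilities minus the probability of \<open>and\<close>. The marginals have the stated asymptotics by the
  definition of \<open>C1\<close> and \<open>C2\<close>. What remains is that these constants are positive and that joint
  ruin is negligible.

  Put \<open>u = (-\<gamma>1, 0)\<close> and \<open>v = (0, -\<gamma>2)\<close>. Ruin of the coordinates means that \<open>u \<bullet> Z\<close> and \<open>v \<bullet> Z\<close> exceed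
  the levels \<open>x = \<gamma>1 a K\<close> and \<open>y = \<gamma>2 K\<close>, and \<open>E exp (u \<bullet> Z 1) = E exp (v \<bullet> Z 1) = 1\<close>.

  Joint ruin. The map \<open>\<theta> \<mapsto> E exp (\<theta> \<bullet> Z 1)\<close> is convex and strictly below \<open>1\<close> at the midpoint of \<open>u\<close> and
  \<open>v\<close>, since equality in the inequality of arithmetic and geometric means would make the ratio of
  the coordinates constant. As the map is finite beyond \<open>u\<close>, there are \<open>r, s\<close> in \<open>[0, 1]\<close> with
  \<open>r + s > 1\<close> at which \<open>E exp ((r u + s v) \<bullet> Z 1) \<le> 1\<close> (lemma \<open>ex_exponent_beyond_segment\<close>). A
  two-dimensional Lundberg inequality bounds the probability that both levels are exceeded by
  \<open>exp (- (r x + s y))\<close> (\<open>exceeds_both_bound\<close>). Because \<open>r x + s y \<ge> (r + s) min x y\<close>, this decays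
  faster than the slower of \<open>exp (-x)\<close> and \<open>exp (-y)\<close>, however \<open>\<gamma>1 a\<close> and \<open>\<gamma>2\<close> compare. The Lundberg
  inequality is proved for the process on finite grids, by induction on the number of steps, and
  passes to the limit along dyadic grids by right-continuity of paths.

  Positive constants. Were \<open>C1 = 0\<close>, the maximum \<open>W\<close> of the walk \<open>u \<bullet> Z n\<close> would have tail \<open>o(e\<^sup>-\<^sup>x)\<close>, so
  that \<open>E exp (\<alpha> W) = o(1 / (1 - \<alpha>))\<close> as \<open>\<alpha>\<close> increases to \<open>1\<close>. The recursion \<open>W = max 0 (\<xi> + W)\<close> in law
  with \<open>E e\<^sup>\<xi> = 1\<close> shows on the contrary that \<open>E exp (\<alpha> W)\<close> grows at least like a positive multiple
  of \<open>1 / (1 - \<alpha>)\<close> (\<open>driven_reflect_tail_lower_bound\<close>); here it matters that \<open>E exp (\<alpha> \<xi>)\<close> has a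
  finite slope at \<open>\<alpha> = 1\<close>, which holds as \<open>u\<close> is interior to the domain of the cumulant.

  In both parts the running maximum over a grid is replaced by a walk reflected at zero, which has
  the same law and is a Markov chain driven by i.i.d. steps.
\<close>

section \<open>Recursions driven by i.i.d. values\<close>

primrec driven :: "('b \<Rightarrow> 's \<Rightarrow> 's) \<Rightarrow> 's \<Rightarrow> (nat \<Rightarrow> 'b) \<Rightarrow> nat \<Rightarrow> 's" where
  "driven g s x 0 = s"
| "driven g s x (Suc n) = g (x n) (driven g s x n)"

text \<open>For i.i.d. driving values with law \<open>\<mu>\<close> this is the law of \<open>driven g s x n\<close>. Giving it a
  recursion of its own makes it visibly independent of the probability space that carries the
  values, so that walks of different lengths can be compared.\<close>

primrec driven_law ::
  "('b::topological_space \<Rightarrow> 's::topological_space \<Rightarrow> 's) \<Rightarrow> 's \<Rightarrow> 'b measure \<Rightarrow> nat \<Rightarrow> 's measure" where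
  "driven_law g s \<mu> 0 = return borel s"
| "driven_law g s \<mu> (Suc n) = distr (\<mu> \<Otimes>\<^sub>M driven_law g s \<mu> n) borel (case_prod g)"

lemma driven_cong:
  "(\<And>i. i < n \<Longrightarrow> x i = y i) \<Longrightarrow> driven g s x n = driven g s y n"
  by (induction n) auto

lemma driven_measurable:
  assumes [measurable]: "case_prod g \<in> borel \<Otimes>\<^sub>M borel \<rightarrow>\<^sub>M borel"
    and n: "n \<le> m"
  shows "(\<lambda>x. driven g s x n) \<in> (\<Pi>\<^sub>M i\<in>{..<m}. borel) \<rightarrow>\<^sub>M borel"
  using n
proof (induction n)
  case (Suc n)
  have [measurable]: "(\<lambda>x. driven g s x n) \<in> (\<Pi>\<^sub>M i\<in>{..<m}. borel) \<rightarrow>\<^sub>M borel"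
    using Suc by simp
  have [measurable]: "(\<lambda>x. x n) \<in> (\<Pi>\<^sub>M i\<in>{..<m}. borel) \<rightarrow>\<^sub>M borel"
    using Suc.prems by (intro measurable_component_singleton) auto
  have "(\<lambda>x. case_prod g (x n, driven g s x n)) \<in> (\<Pi>\<^sub>M i\<in>{..<m}. borel) \<rightarrow>\<^sub>M borel"
    by measurable
  then show ?case by simp
qed simp

context
  fixes g :: "'b::topological_space \<Rightarrow> 's::topological_space \<Rightarrow> 's" and s :: 's and \<mu> :: "'b measure"
  assumes \<mu>: "prob_space \<mu>" "sets \<mu> = sets borel"
    and g [measurable]: "case_prod g \<in> borel \<Otimes>\<^sub>M borel \<rightarrow>\<^sub>M borel"
begin

lemma sets_driven_law [simp, measurable_cong]: "sets (driven_law g s \<mu> n) = sets borel"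
  by (cases n) auto

lemma step_measurable_driven_law: "case_prod g \<in> \<mu> \<Otimes>\<^sub>M driven_law g s \<mu> n \<rightarrow>\<^sub>M borel"
  using g by (subst measurable_cong_sets[OF sets_pair_measure_cong[OF \<mu>(2) sets_driven_law] refl])

lemma prob_space_driven_law: "prob_space (driven_law g s \<mu> n)"
proof (induction n)
  case (Suc n)
  interpret pair_prob_space \<mu> "driven_law g s \<mu> n"
    using \<mu> Suc by (simp add: pair_prob_space_def pair_sigma_finite_def prob_space_imp_sigma_finite)
  show ?case
    using step_measurable_driven_law by (auto intro!: prob_space_distr)
qed (simp add: prob_space_return)

lemma nn_integral_driven_law_Suc:
  assumes [measurable]: "f \<in> borel_measurable borel"
  shows "(\<integral>\<^sup>+w. f w \<partial>driven_law g s \<mu> (Suc n)) =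
    (\<integral>\<^sup>+v. (\<integral>\<^sup>+w. f (g v w) \<partial>driven_law g s \<mu> n) \<partial>\<mu>)"
proof -
  interpret nu: prob_space "driven_law g s \<mu> n" by (rule prob_space_driven_law)
  have m: "(\<lambda>z. f (case_prod g z)) \<in> borel_measurable (\<mu> \<Otimes>\<^sub>M driven_law g s \<mu> n)"
    using measurable_compose[OF step_measurable_driven_law assms] .
  show ?thesis
    using step_measurable_driven_law nu.nn_integral_fst[OF m]
    by (simp add: nn_integral_distr)
qed

lemma emeasure_driven_law_Suc:
  assumes A [measurable]: "A \<in> sets borel"
  shows "emeasure (driven_law g s \<mu> (Suc n)) A =
    (\<integral>\<^sup>+v. emeasure (driven_law g s \<mu> n) {w. g v w \<in> A} \<partial>\<mu>)"
proof -
  have "emeasure (driven_law g s \<mu> (Suc n)) A = (\<integral>\<^sup>+w. indicator A w \<partial>driven_law g s \<mu> (Suc n))"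
    by simp
  also have "\<dots> = (\<integral>\<^sup>+v. (\<integral>\<^sup>+w. indicator A (g v w) \<partial>driven_law g s \<mu> n) \<partial>\<mu>)"
    by (rule nn_integral_driven_law_Suc) simp
  also have "\<dots> = (\<integral>\<^sup>+v. emeasure (driven_law g s \<mu> n) {w. g v w \<in> A} \<partial>\<mu>)"
  proof (intro nn_integral_cong)
    fix v
    assume v: "v \<in> space \<mu>"
    have "(\<lambda>w. case_prod g (v, w)) \<in> borel \<rightarrow>\<^sub>M borel"
      using measurable_compose[OF measurable_Pair1' g, of v] by simp
    from measurable_sets[OF this A] have "{w. g v w \<in> A} \<in> sets (driven_law g s \<mu> n)" by (simp add: vimage_def)
    then have "(\<integral>\<^sup>+w. indicator {w. g v w \<in> A} w \<partial>driven_law g s \<mu> n) =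
      emeasure (driven_law g s \<mu> n) {w. g v w \<in> A}"
      by (rule nn_integral_indicator)
    then show "(\<integral>\<^sup>+w. indicator A (g v w) \<partial>driven_law g s \<mu> n) =
      emeasure (driven_law g s \<mu> n) {w. g v w \<in> A}"
      by (simp add: indicator_def)
  qed
  finally show ?thesis .
qed

text \<open>The state after \<open>n\<close> steps depends on the first \<open>n\<close> driving values only, hence is independent
  of the next one.\<close>

lemma distr_driven:
  assumes "prob_space M"
    and "prob_space.indep_vars M (\<lambda>_. borel) X {..<n}"
    and "\<And>i. i < n \<Longrightarrow> distr M borel (X i) = \<mu>"
  shows "distr M borel (\<lambda>\<omega>. driven g s (\<lambda>i. X i \<omega>) n) = driven_law g s \<mu> n"
proof -
  interpret prob_space M by fact
  show ?thesis using assms(2,3)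
  proof (induction n)
    case 0
    show ?case
      by (intro measure_eqI) (auto simp: emeasure_distr indicator_def emeasure_space_1)
  next
    case (Suc n)
    define W where "W = (\<lambda>\<omega>. driven g s (\<lambda>i. X i \<omega>) n)"
    have IH: "distr M borel W = driven_law g s \<mu> n"
      unfolding W_def by (intro Suc.IH indep_vars_subset[OF Suc.prems(1)] Suc.prems(2)) auto
    \<comment> \<open>\<open>X n\<close> and \<open>W\<close> have different types, so their independence is expressed as a product law,
      obtained from the independence of the two blocks of coordinates on which they depend.\<close>
    let ?P = "\<Pi>\<^sub>M i\<in>{n}. borel :: 'b measure" and ?Q = "\<Pi>\<^sub>M i\<in>{..<n}. borel :: 'b measure"
    let ?p = "\<lambda>\<omega>. restrict (\<lambda>i. X i \<omega>) {n}" and ?q = "\<lambda>\<omega>. restrict (\<lambda>i. X i \<omega>) {..<n}"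
    have ind: "indep_var ?P ?p ?Q ?q"
      by (intro indep_var_restrict[OF Suc.prems(1)]) auto
    then have [measurable]: "?p \<in> M \<rightarrow>\<^sub>M ?P" "?q \<in> M \<rightarrow>\<^sub>M ?Q"
      by (blast dest: indep_var_rv1 indep_var_rv2)+
    have [measurable]: "(\<lambda>f. f n) \<in> ?P \<rightarrow>\<^sub>M borel" "(\<lambda>f. driven g s f n) \<in> ?Q \<rightarrow>\<^sub>M borel"
      using g by (auto intro: driven_measurable)
    have q: "driven g s (?q \<omega>) n = W \<omega>" for \<omega>
      by (auto simp: W_def intro!: driven_cong)
    have X [measurable]: "X n \<in> borel_measurable M"
      using Suc.prems(1) by (auto simp: indep_vars_def)
    have W [measurable]: "W \<in> borel_measurable M"
      using measurable_compose[of ?q M ?Q "\<lambda>f. driven g s f n" borel] unfolding q by simp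
    have joint: "\<mu> \<Otimes>\<^sub>M driven_law g s \<mu> n = distr M (borel \<Otimes>\<^sub>M borel) (\<lambda>\<omega>. (X n \<omega>, W \<omega>))"
    proof -
      have \<mu>: "\<mu> = distr (distr M ?P ?p) borel (\<lambda>f. f n)"
        using Suc.prems(2)[of n] by (subst distr_distr) (auto simp: comp_def)
      have \<nu>: "driven_law g s \<mu> n = distr (distr M ?Q ?q) borel (\<lambda>f. driven g s f n)"
        by (subst distr_distr) (auto simp: comp_def q IH)
      have sf: "sigma_finite_measure (distr (distr M ?Q ?q) borel (\<lambda>f. driven g s f n))"
        unfolding \<nu>[symmetric] by (intro prob_space_imp_sigma_finite prob_space_driven_law)
      have "\<mu> \<Otimes>\<^sub>M driven_law g s \<mu> n = distr (distr M ?P ?p \<Otimes>\<^sub>M distr M ?Q ?q) (borel \<Otimes>\<^sub>M borel)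
          (\<lambda>(f, h). (f n, driven g s h n))"
        unfolding \<nu> by (subst (1) \<mu>, subst pair_measure_distr)
          (auto intro: sf)
      also have "distr M ?P ?p \<Otimes>\<^sub>M distr M ?Q ?q = distr M (?P \<Otimes>\<^sub>M ?Q) (\<lambda>\<omega>. (?p \<omega>, ?q \<omega>))"
        using ind by (simp add: indep_var_distribution_eq)
      finally show ?thesis
        by (subst (asm) distr_distr) (auto simp: comp_def q)
    qed
    have "distr M borel (\<lambda>\<omega>. case_prod g (X n \<omega>, W \<omega>)) =
        distr (distr M (borel \<Otimes>\<^sub>M borel) (\<lambda>\<omega>. (X n \<omega>, W \<omega>))) borel (case_prod g)"
      by (subst distr_distr) (auto simp: comp_def)
    then show ?case by (simp add: joint W_def[symmetric]) (simp add: W_def)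
  qed
qed

end

section \<open>Walks reflected at zero\<close>

definition reflect :: "real \<Rightarrow> real \<Rightarrow> real" where
  "reflect x w = max 0 (x + w)"

definition reflect_pair :: "real \<times> real \<Rightarrow> real \<times> real \<Rightarrow> real \<times> real" where
  "reflect_pair x w = (reflect (fst x) (fst w), reflect (snd x) (snd w))"

lemma reflect_measurable [measurable]: "case_prod reflect \<in> borel \<Otimes>\<^sub>M borel \<rightarrow>\<^sub>M borel"
  unfolding reflect_def split_def by measurable

lemma reflect_pair_measurable [measurable]: "case_prod reflect_pair \<in> borel \<Otimes>\<^sub>M borel \<rightarrow>\<^sub>M borel"
  unfolding reflect_pair_def reflect_def split_def borel_prod[symmetric] by measurable

lemma driven_reflect_pair:
  "driven reflect_pair (0, 0) x n =
    (driven reflect 0 (\<lambda>i. fst (x i)) n, driven reflect 0 (\<lambda>i. snd (x i)) n)"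
  by (induction n) (auto simp: reflect_pair_def)

text \<open>The classical duality: the walk reflected at \<open>0\<close> is the maximum of the sums over final
  segments of its steps. With the steps listed backwards in time these are partial sums, so the
  reflected walk has the law of a running maximum.\<close>

lemma less_driven_reflect_iff:
  "y < driven reflect 0 x n \<longleftrightarrow> (\<exists>k\<le>n. y < (\<Sum>i\<in>{n-k..<n}. x i))"
proof (induction n arbitrary: y)
  case (Suc n)
  have "y < driven reflect 0 x (Suc n) \<longleftrightarrow> y < 0 \<or> y - x n < driven reflect 0 x n"
    by (auto simp: reflect_def)
  also have "\<dots> \<longleftrightarrow> y < 0 \<or> (\<exists>k\<le>n. y < (\<Sum>i\<in>{n-k..<Suc n}. x i))"
    
    by (auto simp: Suc.IH algebra_simps Suc_diff_le)
  also have "\<dots> \<longleftrightarrow> (\<exists>k\<le>Suc n. y < (\<Sum>i\<in>{Suc n-k..<Suc n}. x i))"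
    (is "?l \<longleftrightarrow> (\<exists>k\<le>Suc n. ?P k)")
  proof -
    have "(\<exists>k\<le>Suc n. ?P k) \<longleftrightarrow> ?P 0 \<or> (\<exists>k\<le>n. ?P (Suc k))"
      by (metis Suc_le_mono le0 not0_implies_Suc)
    then show ?thesis by simp
  qed
  finally show ?case .
qed simp

section \<open>A lower bound for the tail of the reflected walk\<close>

lemma nn_integral_exp_le_1:
  fixes \<mu> :: "real measure"
  assumes \<mu>: "prob_space \<mu>" "sets \<mu> = sets borel"
    and one: "(\<integral>\<^sup>+x. exp x \<partial>\<mu>) = 1"
    and \<alpha>: "0 \<le> \<alpha>" "\<alpha> \<le> 1"
  shows "(\<integral>\<^sup>+x. exp (\<alpha> * x) \<partial>\<mu>) \<le> 1"
proof -
  interpret prob_space \<mu> by fact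
  note [measurable_cong] = \<mu>(2)
  have "(\<integral>\<^sup>+x. exp (\<alpha> * x) \<partial>\<mu>) \<le>
      (\<integral>\<^sup>+x. ennreal (1 - \<alpha>) + ennreal \<alpha> * ennreal (exp x) \<partial>\<mu>)"
  proof (intro nn_integral_mono)
    fix x :: real
    have "exp ((1 - \<alpha>) *\<^sub>R 0 + \<alpha> *\<^sub>R x) \<le> (1 - \<alpha>) * exp 0 + \<alpha> * exp x"
      using \<alpha> by (intro convex_onD[OF exp_convex]) auto
    then show "ennreal (exp (\<alpha> * x)) \<le> ennreal (1 - \<alpha>) + ennreal \<alpha> * ennreal (exp x)"
      using \<alpha> by (simp add: ennreal_mult[symmetric] ennreal_plus[symmetric] ennreal_leI del: ennreal_plus)
  qed
  also have "\<dots> = ennreal (1 - \<alpha>) + ennreal \<alpha>"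
    using one by (simp add: nn_integral_add nn_integral_cmult emeasure_space_1)
  also have "\<dots> = 1" using \<alpha> by (simp add: ennreal_plus[symmetric] del: ennreal_plus)
  finally show ?thesis .
qed

text \<open>The moment generating function has finite left derivative at \<open>1\<close> because it is finite a
  little further to the right: from \<open>e\<^sup>y \<ge> 1 + y\<close> one gets \<open>e\<^sup>x - exp (\<alpha> x) \<le> (1 - \<alpha>) x e\<^sup>x\<close>, and the
  factor \<open>x\<close> is absorbed by \<open>\<epsilon> x \<le> exp (\<epsilon> x)\<close>.\<close>

lemma nn_integral_exp_difference:
  fixes \<mu> :: "real measure"
  assumes \<mu>: "sets \<mu> = sets borel" and \<epsilon>: "0 < \<epsilon>" and \<alpha>: "0 \<le> \<alpha>" "\<alpha> \<le> 1"
  shows "(\<integral>\<^sup>+x. exp x \<partial>\<mu>) \<le>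
    (\<integral>\<^sup>+x. exp (\<alpha> * x) \<partial>\<mu>) + ennreal ((1 - \<alpha>) / \<epsilon>) * (\<integral>\<^sup>+x. exp ((1 + \<epsilon>) * x) \<partial>\<mu>)"
proof -
  note [measurable_cong] = \<mu>
  have pt: "exp x \<le> exp (\<alpha> * x) + (1 - \<alpha>) / \<epsilon> * exp ((1 + \<epsilon>) * x)" for x :: real
  proof -
    have "1 - (1 - \<alpha>) * x \<le> exp (- ((1 - \<alpha>) * x))"
      using exp_ge_add_one_self[of "- ((1 - \<alpha>) * x)"] by simp
    moreover have "(1 - \<alpha>) * x \<le> (1 - \<alpha>) * (exp (\<epsilon> * x) / \<epsilon>)"
    proof (intro mult_left_mono)
      have "\<epsilon> * x \<le> exp (\<epsilon> * x)" using exp_ge_add_one_self[of "\<epsilon> * x"] by linarith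
      then show "x \<le> exp (\<epsilon> * x) / \<epsilon>" using \<epsilon> by (simp add: pos_le_divide_eq mult.commute)
    qed (use \<alpha> in simp)
    ultimately have "1 \<le> exp (- ((1 - \<alpha>) * x)) + (1 - \<alpha>) / \<epsilon> * exp (\<epsilon> * x)" by simp
    then have "exp x * 1 \<le> exp x * (exp (- ((1 - \<alpha>) * x)) + (1 - \<alpha>) / \<epsilon> * exp (\<epsilon> * x))"
      by (intro mult_left_mono) auto
    also have "\<dots> = exp (x - (1 - \<alpha>) * x) + (1 - \<alpha>) / \<epsilon> * exp (x + \<epsilon> * x)"
      by (simp add: exp_add exp_diff exp_minus field_simps)
    finally show ?thesis by (simp add: algebra_simps)
  qed
  have "(\<integral>\<^sup>+x. ennreal (exp x) \<partial>\<mu>) \<le>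
      (\<integral>\<^sup>+x. ennreal (exp (\<alpha> * x)) + ennreal ((1 - \<alpha>) / \<epsilon>) * ennreal (exp ((1 + \<epsilon>) * x)) \<partial>\<mu>)"
  proof (intro nn_integral_mono)
    fix x :: real
    show "ennreal (exp x) \<le> ennreal (exp (\<alpha> * x)) + ennreal ((1 - \<alpha>) / \<epsilon>) * ennreal (exp ((1 + \<epsilon>) * x))"
      using pt[of x] \<alpha> \<epsilon>
      by (simp add: ennreal_mult[symmetric] ennreal_plus[symmetric] ennreal_leI del: ennreal_plus)
  qed
  also have "\<dots> = (\<integral>\<^sup>+x. exp (\<alpha> * x) \<partial>\<mu>) + ennreal ((1 - \<alpha>) / \<epsilon>) * (\<integral>\<^sup>+x. exp ((1 + \<epsilon>) * x) \<partial>\<mu>)"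
    by (simp add: nn_integral_add nn_integral_cmult)
  finally show ?thesis .
qed

text \<open>The walk starts at the lowest point of its range, so its laws increase stochastically: one
  step from \<open>0\<close> cannot go below \<open>0\<close>, and the step map preserves the order.\<close>

lemma nn_integral_driven_reflect_mono:
  assumes \<mu>: "prob_space \<mu>" "sets \<mu> = sets borel"
    and h: "h \<in> borel_measurable borel" "mono h"
  shows "(\<integral>\<^sup>+w. h w \<partial>driven_law reflect 0 \<mu> n) \<le> (\<integral>\<^sup>+w. h w \<partial>driven_law reflect 0 \<mu> (Suc n))"
  using h
proof (induction n arbitrary: h)
  case 0
  interpret \<mu>: prob_space \<mu> by fact
  note [measurable] = 0(1)
  have "(\<integral>\<^sup>+w. h w \<partial>driven_law reflect 0 \<mu> 0) = (\<integral>\<^sup>+x. h 0 \<partial>\<mu>)"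
    by (simp add: nn_integral_return \<mu>.emeasure_space_1)
  also have "\<dots> \<le> (\<integral>\<^sup>+x. h (reflect x 0) \<partial>\<mu>)"
    using 0(2) by (intro nn_integral_mono) (auto simp: mono_def reflect_def)
  also have "\<dots> = (\<integral>\<^sup>+w. h w \<partial>driven_law reflect 0 \<mu> (Suc 0))"
    by (subst nn_integral_driven_law_Suc[OF \<mu> reflect_measurable 0(1)])
      (simp add: nn_integral_return reflect_def)
  finally show ?case .
next
  case (Suc n)
  note [measurable] = Suc.prems(1)
  have "(\<integral>\<^sup>+w. h (reflect x w) \<partial>driven_law reflect 0 \<mu> n) \<le>
      (\<integral>\<^sup>+w. h (reflect x w) \<partial>driven_law reflect 0 \<mu> (Suc n))" for x
    using Suc.prems(2) by (intro Suc.IH) (auto simp: mono_def reflect_def)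
  then show ?case
    unfolding nn_integral_driven_law_Suc[OF \<mu> reflect_measurable Suc.prems(1)]
    by (intro nn_integral_mono)
qed

text \<open>A geometric series over unit intervals turns the tail bound into a bound on exponential
  moments; the pole at \<open>\<delta> = 0\<close> has a residue proportional to \<open>\<eta>\<close>.\<close>

lemma nn_integral_exp_le_of_tail:
  fixes \<nu> :: "real measure"
  assumes \<nu>: "prob_space \<nu>" "sets \<nu> = sets borel"
    and x0: "0 \<le> x0" and \<eta>: "0 \<le> \<eta>"
    and tail: "\<And>x. x0 \<le> x \<Longrightarrow> emeasure \<nu> {x<..} \<le> ennreal (\<eta> * exp (- x))"
    and \<delta>: "0 < \<delta>" "\<delta> \<le> 1"
  shows "(\<integral>\<^sup>+w. exp ((1 - \<delta>) * w) \<partial>\<nu>) \<le> ennreal (exp x0 + 2 * \<eta> * exp 1 / \<delta>)"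
proof -
  interpret prob_space \<nu> by fact
  note [measurable_cong] = \<nu>(2)
  let ?\<alpha> = "1 - \<delta>"
  have pt: "ennreal (exp (?\<alpha> * w)) \<le>
      ennreal (exp x0) + (\<Sum>k. ennreal (exp (?\<alpha> * (x0 + k + 1))) * indicator {x0 + real k<..} w)" for w
  proof (cases "w \<le> x0")
    case True
    have "?\<alpha> * w \<le> ?\<alpha> * x0" using True \<delta> by (intro mult_left_mono) auto
    also have "\<dots> \<le> x0" using x0 \<delta> by (simp add: mult_left_le_one_le)
    finally show ?thesis by (intro add_increasing2) (auto intro!: ennreal_leI)
  next
    case False
    define k where "k = nat (\<lceil>w - x0\<rceil> - 1)"
    have k: "real k < w - x0" "w - x0 \<le> real k + 1"
      unfolding k_def using False by linarith+
    have "ennreal (exp (?\<alpha> * w)) \<le> ennreal (exp (?\<alpha> * (x0 + k + 1))) * indicator {x0 + real k<..} w"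
      using k \<delta> by (auto intro!: ennreal_leI mult_left_mono)
    also have "\<dots> \<le> (\<Sum>k. ennreal (exp (?\<alpha> * (x0 + k + 1))) * indicator {x0 + real k<..} w)"
    proof -
      have "sum f {k} \<le> suminf f" for f :: "nat \<Rightarrow> ennreal"
        by (intro sum_le_suminf summableI) auto
      then show ?thesis unfolding sum.insert_remove[OF finite.emptyI] by simp
    qed
    finally show ?thesis by (intro add_increasing) auto
  qed
  have geo: "(\<lambda>k. exp 1 * \<eta> * exp (- \<delta>) ^ k) sums (exp 1 * \<eta> * (1 / (1 - exp (- \<delta>))))"
    using \<delta> by (intro sums_mult geometric_sums) auto
  have "(\<integral>\<^sup>+w. exp (?\<alpha> * w) \<partial>\<nu>) \<le> (\<integral>\<^sup>+w. ennreal (exp x0) +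
      (\<Sum>k. ennreal (exp (?\<alpha> * (x0 + k + 1))) * indicator {x0 + real k<..} w) \<partial>\<nu>)"
    by (intro nn_integral_mono pt)
  also have "\<dots> = ennreal (exp x0) + (\<Sum>k. ennreal (exp (?\<alpha> * (x0 + k + 1))) * emeasure \<nu> {x0 + real k<..})"
    by (simp add: nn_integral_add nn_integral_suminf nn_integral_cmult emeasure_space_1 nn_integral_cmult_indicator \<nu>(2))
  also have "\<dots> \<le> ennreal (exp x0) + (\<Sum>k. ennreal (exp 1 * \<eta> * exp (- \<delta>) ^ k))"
  proof (intro add_left_mono suminf_le)
    fix k :: nat
    have "ennreal (exp (?\<alpha> * (x0 + k + 1))) * emeasure \<nu> {x0 + real k<..}
        \<le> ennreal (exp (?\<alpha> * (x0 + k + 1))) * ennreal (\<eta> * exp (- (x0 + k)))"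
      by (intro mult_left_mono tail) auto
    also have "\<dots> = ennreal (\<eta> * (exp (?\<alpha> * (x0 + k + 1)) * exp (- (x0 + k))))"
      using \<eta> by (simp add: ennreal_mult[symmetric] mult_ac)
    also have "\<dots> \<le> ennreal (\<eta> * (exp 1 * exp (- \<delta>) ^ k))"
    proof (intro ennreal_leI mult_left_mono \<eta>)
      have "?\<alpha> * (x0 + k + 1) - (x0 + k) \<le> 1 + real k * (- \<delta>)"
        using \<delta> x0 mult_nonneg_nonneg[of \<delta> x0] by (simp add: algebra_simps)
      then have "exp (?\<alpha> * (x0 + k + 1) + - (x0 + k)) \<le> exp (1 + real k * (- \<delta>))" by simp
      then show "exp (?\<alpha> * (x0 + k + 1)) * exp (- (x0 + k)) \<le> exp 1 * exp (- \<delta>) ^ k"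
        unfolding exp_add exp_of_nat_mult .
    qed
    finally show "ennreal (exp (?\<alpha> * (x0 + k + 1))) * emeasure \<nu> {x0 + real k<..}
        \<le> ennreal (exp 1 * \<eta> * exp (- \<delta>) ^ k)" by (simp add: mult_ac)
  qed auto
  also have "\<dots> = ennreal (exp x0 + exp 1 * \<eta> * (1 / (1 - exp (- \<delta>))))"
    using \<eta> \<delta>
    by (subst suminf_ennreal_eq[OF _ geo]) (auto simp: ennreal_plus)
  also have "\<dots> \<le> ennreal (exp x0 + 2 * \<eta> * exp 1 / \<delta>)"
  proof (intro ennreal_leI add_left_mono)
    have "exp (- \<delta>) \<le> 1 / (1 + \<delta>)"
      using exp_ge_add_one_self[of \<delta>] \<delta> by (simp add: exp_minus field_simps)
    also have "\<dots> \<le> 1 - \<delta> / 2"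
    proof -
      have "\<delta> * \<delta> \<le> \<delta> * 1" using \<delta> by (intro mult_left_mono) auto
      then show ?thesis using \<delta> by (simp add: field_simps)
    qed
    finally have "\<delta> / 2 \<le> 1 - exp (- \<delta>)" by simp
    then have "1 / (1 - exp (- \<delta>)) \<le> 1 / (\<delta> / 2)"
      using \<delta> by (intro divide_left_mono) auto
    then have "exp 1 * \<eta> * (1 / (1 - exp (- \<delta>))) \<le> exp 1 * \<eta> * (1 / (\<delta> / 2))"
      using \<eta> by (intro mult_left_mono) auto
    then show "exp 1 * \<eta> * (1 / (1 - exp (- \<delta>))) \<le> 2 * \<eta> * exp 1 / \<delta>"
      by (simp add: mult_ac)
  qed
  finally show ?thesis .
qed

text \<open>If \<open>F\<close> stays bounded, its supremum \<open>L\<close> satisfies \<open>p L + c \<le> L\<close>.\<close>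

lemma affine_recursion_bound:
  fixes F :: "nat \<Rightarrow> real"
  assumes rec: "\<And>n. p * F n + c \<le> F (Suc n)" and B: "\<And>n. F n \<le> B" and p: "0 \<le> p" "p \<le> 1"
  shows "c \<le> (1 - p) * B"
proof -
  define L where "L = (SUP n. F n)"
  have bdd: "bdd_above (range F)" using B by (intro bdd_aboveI2[where M = B]) auto
  have le: "F n \<le> L" for n unfolding L_def using bdd by (rule cSUP_upper2) auto
  have "p * L + c \<le> L"
  proof (cases "p = 0")
    case True
    then show ?thesis using rec[of 0] le[of 1] by simp
  next
    case False
    have "F n \<le> (L - c) / p" for n
      using False p rec[of n] le[of "Suc n"] by (simp add: field_simps)
    then have "L \<le> (L - c) / p" unfolding L_def by (intro cSUP_least) auto
    then show ?thesis using False p by (simp add: field_simps)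
  qed
  then have "c \<le> (1 - p) * L" by (simp add: algebra_simps)
  also have "L \<le> B" unfolding L_def using B by (intro cSUP_least) auto
  then have "(1 - p) * L \<le> (1 - p) * B" using p by (intro mult_left_mono) auto
  finally show ?thesis .
qed

text \<open>This is the lower bound in the Cramer-Lundberg estimate. Write \<open>\<phi> \<alpha>\<close> for the moment generating
  function of the step and \<open>F n \<alpha>\<close> for that of the walk at time \<open>n\<close>. Conditioning on the last step
  gives \<open>F (n + 1) \<alpha> = \<phi> \<alpha> F n \<alpha> + c n \<alpha>\<close>, where \<open>c n \<alpha>\<close> is the gain from reflection. For \<open>\<alpha> \<ge> 1/2\<close>
  the gain is at least \<open>1 - \<phi> (1/2) > 0\<close>, while \<open>1 - \<phi> \<alpha> = O(1 - \<alpha>)\<close>; hence the supremum of \<open>F n \<alpha>\<close>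
  over \<open>n\<close> blows up at least like a constant multiple of \<open>1 / (1 - \<alpha>)\<close> as \<open>\<alpha>\<close> increases to \<open>1\<close>. Tails
  that are eventually below \<open>\<eta> e\<^sup>-\<^sup>x\<close> would allow only a multiple of \<open>\<eta> / (1 - \<alpha>)\<close>, which is a
  contradiction for small \<open>\<eta>\<close>.\<close>

lemma driven_reflect_tail_lower_bound:
  fixes \<mu> :: "real measure"
  assumes \<mu>: "prob_space \<mu>" "sets \<mu> = sets borel"
    and one: "(\<integral>\<^sup>+x. exp x \<partial>\<mu>) = 1"
    and half: "(\<integral>\<^sup>+x. exp (x / 2) \<partial>\<mu>) < 1"
    and eps: "0 < \<epsilon>" "(\<integral>\<^sup>+x. exp ((1 + \<epsilon>) * x) \<partial>\<mu>) < \<infinity>"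
  shows "\<exists>\<eta>>0. \<forall>x0. \<exists>x\<ge>x0. \<exists>n.
    ennreal (\<eta> * exp (- x)) < emeasure (driven_law reflect 0 \<mu> n) {x<..}"
proof -
  interpret \<mu>: prob_space \<mu> by fact
  note [measurable_cong] = \<mu>(2)
  let ?\<nu> = "driven_law reflect 0 \<mu>"
  note rm = reflect_measurable
  have sets_\<nu> [simp, measurable_cong]: "sets (?\<nu> n) = sets borel" for n
    using sets_driven_law[OF \<mu> rm] .
  have p\<nu>: "prob_space (?\<nu> n)" for n using prob_space_driven_law[OF \<mu> rm] .
  define \<phi> where "\<phi> \<alpha> = (\<integral>\<^sup>+x. ennreal (exp (\<alpha> * x)) \<partial>\<mu>)" for \<alpha> :: real
  define F where "F n \<alpha> = (\<integral>\<^sup>+w. ennreal (exp (\<alpha> * w)) \<partial>?\<nu> n)" for n and \<alpha> :: real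
  define c where "c n \<alpha> = (\<integral>\<^sup>+x. \<integral>\<^sup>+w. ennreal (1 - exp (\<alpha> * (x + w))) \<partial>?\<nu> n \<partial>\<mu>)" for n and \<alpha> :: real
  have \<phi>2: "\<phi> (1/2) < 1" using half by (simp add: \<phi>_def)
  have \<phi>3: "\<phi> (1 + \<epsilon>) < \<infinity>" using eps by (simp add: \<phi>_def)
  have \<phi>_le: "\<phi> \<alpha> \<le> 1" if "0 \<le> \<alpha>" "\<alpha> \<le> 1" for \<alpha>
    unfolding \<phi>_def using nn_integral_exp_le_1[OF \<mu> one that] .
  have rec: "F (Suc n) \<alpha> = \<phi> \<alpha> * F n \<alpha> + c n \<alpha>" if "0 \<le> \<alpha>" for n \<alpha>
  proof -
    interpret \<nu>: prob_space "?\<nu> n" by (rule p\<nu>)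
    \<comment> \<open>\<open>ennreal\<close> truncates at \<open>0\<close>, so the last summand vanishes unless the step is reflected.\<close>
    have e: "ennreal (exp (\<alpha> * reflect x w)) =
        ennreal (exp (\<alpha> * x)) * ennreal (exp (\<alpha> * w)) + ennreal (1 - exp (\<alpha> * (x + w)))" for x w
    proof (cases "0 \<le> x + w")
      case True
      then have "0 \<le> \<alpha> * (x + w)" using that by simp
      then have "1 - exp (\<alpha> * (x + w)) \<le> 0" by simp
      then show ?thesis using True
        by (simp add: reflect_def ennreal_mult[symmetric] exp_add[symmetric] algebra_simps ennreal_neg)
    next
      case False
      then have "\<alpha> * (x + w) \<le> 0" using that by (simp add: mult_nonneg_nonpos)
      then show ?thesis using False
        by (simp add: reflect_def ennreal_mult[symmetric] exp_add[symmetric] algebra_simps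
            ennreal_plus[symmetric] del: ennreal_plus)
    qed
    have "F (Suc n) \<alpha> = (\<integral>\<^sup>+x. \<integral>\<^sup>+w. ennreal (exp (\<alpha> * reflect x w)) \<partial>?\<nu> n \<partial>\<mu>)"
      unfolding F_def by (rule nn_integral_driven_law_Suc[OF \<mu> rm]) simp
    also have "\<dots> = (\<integral>\<^sup>+x. ennreal (exp (\<alpha> * x)) * F n \<alpha> +
        (\<integral>\<^sup>+w. ennreal (1 - exp (\<alpha> * (x + w))) \<partial>?\<nu> n) \<partial>\<mu>)"
      unfolding e F_def by (subst nn_integral_add) (auto simp: nn_integral_cmult)
    also have "\<dots> = \<phi> \<alpha> * F n \<alpha> + c n \<alpha>"
      unfolding \<phi>_def c_def by (subst nn_integral_add) (auto simp: nn_integral_multc)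
    finally show ?thesis .
  qed
  \<comment> \<open>A first crude bound, needed only to pass from extended to real numbers.\<close>
  have c_le1: "c n \<alpha> \<le> 1" for n \<alpha>
  proof -
    interpret \<nu>: prob_space "?\<nu> n" by (rule p\<nu>)
    have "c n \<alpha> \<le> (\<integral>\<^sup>+x. \<integral>\<^sup>+w. 1 \<partial>?\<nu> n \<partial>\<mu>)"
      unfolding c_def by (intro nn_integral_mono) auto
    then show ?thesis by (simp add: \<nu>.emeasure_space_1 \<mu>.emeasure_space_1)
  qed
  have F0: "F 0 \<alpha> = 1" for \<alpha>
    by (simp add: F_def nn_integral_return)
  have F_fin: "F n \<alpha> < \<infinity>" if "0 \<le> \<alpha>" "\<alpha> \<le> 1" for n \<alpha>
  proof (induction n)
    case (Suc n)
    have "\<phi> \<alpha> < \<infinity>" using \<phi>_le[OF that] by (simp add: le_less_trans)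
    moreover have "c n \<alpha> < \<infinity>" using c_le1[of n \<alpha>] by (simp add: le_less_trans)
    ultimately show ?case using Suc that by (simp add: rec ennreal_mult_less_top)
  qed (simp add: F0)
  have F_mono: "F n \<alpha> \<le> F (Suc n) \<alpha>" if "0 \<le> \<alpha>" for n \<alpha>
    unfolding F_def using that
    by (intro nn_integral_driven_reflect_mono[OF \<mu>]) (auto simp: mono_def intro!: ennreal_leI mult_left_mono)
  have F_ge1: "1 \<le> F n \<alpha>" if "0 \<le> \<alpha>" for n \<alpha>
    using lift_Suc_mono_le[of "\<lambda>n. F n \<alpha>" 0 n] F_mono that F0[of \<alpha>] by simp
  have c_mono: "c n (1/2) \<le> c n \<alpha>" if "1/2 \<le> \<alpha>" for n \<alpha>
    unfolding c_def
  proof (intro nn_integral_mono)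
    fix x w :: real
    show "ennreal (1 - exp (1/2 * (x + w))) \<le> ennreal (1 - exp (\<alpha> * (x + w)))"
    proof (cases "0 \<le> x + w")
      case True
      then have "1 - exp (1/2 * (x + w)) \<le> 0" by simp
      then show ?thesis by (simp add: ennreal_neg)
    next
      case False
      then have "\<alpha> * (x + w) \<le> 1/2 * (x + w)" using that by (intro mult_right_mono_neg) auto
      then show ?thesis by (intro ennreal_leI) simp
    qed
  qed
  define fr where "fr n \<alpha> = enn2real (F n \<alpha>)" for n \<alpha>
  define pr where "pr \<alpha> = enn2real (\<phi> \<alpha>)" for \<alpha>
  define c0 where "c0 = 1 - pr (1/2)"
  define D where "D = enn2real (\<phi> (1 + \<epsilon>)) / \<epsilon>"
  have fr: "F n \<alpha> = ennreal (fr n \<alpha>)" "0 \<le> fr n \<alpha>" if "0 \<le> \<alpha>" "\<alpha> \<le> 1" for n \<alpha>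
    using F_fin[OF that] by (auto simp: fr_def)
  have pr: "\<phi> \<alpha> = ennreal (pr \<alpha>)" "0 \<le> pr \<alpha>" "pr \<alpha> \<le> 1" if "0 \<le> \<alpha>" "\<alpha> \<le> 1" for \<alpha>
    using \<phi>_le[OF that] unfolding pr_def by (auto simp: less_top[symmetric] top_unique intro!: ennreal_enn2real[symmetric] enn2real_leI)
  have pr2: "pr (1/2) < 1"
    using \<phi>2 pr[of "1/2"] by (simp add: ennreal_less_one_iff)
  have c0: "0 < c0" using pr2 by (simp add: c0_def)
  have D: "0 \<le> D" using eps by (simp add: D_def)
  \<comment> \<open>At \<open>\<alpha> = 1/2\<close> the step contracts, so the gain must make up for it to keep \<open>F n\<close> increasing.\<close>
  have cr: "ennreal c0 \<le> c n \<alpha>" if "1/2 \<le> \<alpha>" for n \<alpha>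
  proof -
    have "ennreal (fr n (1/2)) \<le> ennreal (pr (1/2) * fr n (1/2)) + c n (1/2)"
      using F_mono[of "1/2" n] fr[of "1/2" n] fr[of "1/2" "Suc n"] pr[of "1/2"] 
      by (simp add: rec ennreal_mult)
    moreover obtain r where r: "0 \<le> r" "c n (1/2) = ennreal r"
      using c_le1[of n "1/2"] by (cases "c n (1/2)") (auto simp: top_unique)
    ultimately have "fr n (1/2) \<le> pr (1/2) * fr n (1/2) + r"
      using fr[of "1/2" n] pr[of "1/2"] by (simp add: ennreal_plus[symmetric] del: ennreal_plus)
    then have "c0 * fr n (1/2) \<le> r" by (simp add: c0_def algebra_simps)
    moreover have "1 \<le> fr n (1/2)" using F_ge1[of "1/2" n] fr[of "1/2" n] by simp
    moreover have "c0 * 1 \<le> c0 * fr n (1/2)" if "1 \<le> fr n (1/2)"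
      using that c0 by (intro mult_left_mono) auto
    ultimately have "c0 \<le> r" by simp
    then have "ennreal c0 \<le> c n (1/2)" by (simp add: r ennreal_leI)
    also have "\<dots> \<le> c n \<alpha>" using that by (rule c_mono)
    finally show ?thesis .
  qed
  have rec_r: "pr \<alpha> * fr n \<alpha> + c0 \<le> fr (Suc n) \<alpha>" if "1/2 \<le> \<alpha>" "\<alpha> \<le> 1" for n \<alpha>
  proof -
    have "ennreal (pr \<alpha> * fr n \<alpha> + c0) \<le> ennreal (fr (Suc n) \<alpha>)"
      using that rec[of \<alpha> n] fr[of \<alpha> n] fr[of \<alpha> "Suc n"] pr[of \<alpha>] cr[of \<alpha> n] c0
      by (simp add: ennreal_mult add_left_mono)
    then show ?thesis using fr[of \<alpha> "Suc n"] that by (simp add: ennreal_le_iff)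
  qed
  have slope: "1 - pr \<alpha> \<le> D * (1 - \<alpha>)" if "0 \<le> \<alpha>" "\<alpha> \<le> 1" for \<alpha>
  proof -
    have "1 \<le> \<phi> \<alpha> + ennreal ((1 - \<alpha>) / \<epsilon>) * \<phi> (1 + \<epsilon>)"
      using nn_integral_exp_difference[OF \<mu>(2) eps(1) that] one by (simp add: \<phi>_def)
    also have "\<phi> (1 + \<epsilon>) = ennreal (D * \<epsilon>)"
      using \<phi>3 eps by (simp add: D_def)
    also have "\<phi> \<alpha> + ennreal ((1 - \<alpha>) / \<epsilon>) * ennreal (D * \<epsilon>) = ennreal (pr \<alpha> + D * (1 - \<alpha>))"
      using that eps pr[OF that] D
      by (simp add: ennreal_mult[symmetric] ennreal_plus[symmetric] mult.commute del: ennreal_plus)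
    finally have "ennreal 1 \<le> ennreal (pr \<alpha> + D * (1 - \<alpha>))" by simp
    then have "1 \<le> pr \<alpha> + D * (1 - \<alpha>)"
      using pr[OF that] D that by (subst (asm) ennreal_le_iff) auto
    then show ?thesis by simp
  qed
  \<comment> \<open>The constants make each of the two terms of the upper bound at most \<open>c0 / 4\<close>;
    \<open>D + 1\<close> replaces \<open>D\<close> only to have a positive denominator.\<close>
  define \<eta> where "\<eta> = c0 / (8 * exp 1 * (D + 1))"
  have \<eta>: "0 < \<eta>" using c0 D by (simp add: \<eta>_def)
  have "\<exists>x\<ge>x0. \<exists>n. ennreal (\<eta> * exp (- x)) < emeasure (?\<nu> n) {x<..}" for x0
  proof (rule ccontr)
    assume neg: "\<not> ?thesis"
    define x1 where "x1 = max 0 x0"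
    have tail: "emeasure (?\<nu> n) {x<..} \<le> ennreal (\<eta> * exp (- x))" if "x1 \<le> x" for x n
      using neg that by (auto simp: x1_def not_less)
    define \<delta> where "\<delta> = min (1/2) (c0 / (4 * (D + 1) * exp x1))"
    have \<delta>: "0 < \<delta>" "\<delta> \<le> 1/2" "\<delta> \<le> c0 / (4 * (D + 1) * exp x1)"
      using c0 D unfolding \<delta>_def by (simp, intro min.cobounded1, intro min.cobounded2)
    have ub: "fr n (1 - \<delta>) \<le> exp x1 + 2 * \<eta> * exp 1 / \<delta>" for n
    proof -
      have "F n (1 - \<delta>) \<le> ennreal (exp x1 + 2 * \<eta> * exp 1 / \<delta>)"
        unfolding F_def using p\<nu> tail \<delta> \<eta>
        by (intro nn_integral_exp_le_of_tail) (auto simp: x1_def)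
      then show ?thesis
        using fr[of "1 - \<delta>" n] \<delta> \<eta> by (simp add: ennreal_le_iff del: ennreal_plus)
    qed
    have "c0 \<le> (1 - pr (1 - \<delta>)) * (exp x1 + 2 * \<eta> * exp 1 / \<delta>)"
      using rec_r ub pr[of "1 - \<delta>"] \<delta> by (intro affine_recursion_bound[where F = "\<lambda>n. fr n (1 - \<delta>)"]) auto
    also have "\<dots> \<le> ((D + 1) * \<delta>) * (exp x1 + 2 * \<eta> * exp 1 / \<delta>)"
      using slope[of "1 - \<delta>"] \<delta> \<eta> by (intro mult_right_mono) (auto simp: algebra_simps)
    also have "\<dots> = \<delta> * ((D + 1) * exp x1) + 2 * \<eta> * exp 1 * (D + 1)"
      using \<delta> by (simp add: field_simps)
    also have "2 * \<eta> * exp 1 * (D + 1) = c0 / 4"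
    proof -
      have "8 * exp 1 * (D + 1) \<noteq> 0" using D by simp
      then have "\<eta> * (8 * exp 1 * (D + 1)) = c0"
        unfolding \<eta>_def by (rule nonzero_eq_divide_eq[THEN iffD1]) (rule refl)
      then show ?thesis by (simp add: algebra_simps)
    qed
    also have "\<delta> * ((D + 1) * exp x1) \<le> c0 / (4 * (D + 1) * exp x1) * ((D + 1) * exp x1)"
      using \<delta> D by (intro mult_right_mono) auto
    also have "\<dots> = c0 / 4"
    proof -
      have "c0 / (4 * d * e) * (d * e) = c0 / 4" if "d \<noteq> 0" "e \<noteq> 0" for d e :: real
        using that by simp
      from this[of "D + 1" "exp x1"] show ?thesis using D by simp
    qed
    finally show False using c0 by simp
  qed
  then show ?thesis using \<eta> by blast
qed

section \<open>Joint exponential tails of two reflected walks\<close>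

context
  fixes \<mu> :: "(real \<times> real) measure"
  assumes \<mu>: "prob_space \<mu>" "sets \<mu> = sets borel"
begin

text \<open>Lundberg's inequality for one coordinate \<open>p\<close>, proved by conditioning on the last step.\<close>

lemma reflect_pair_tail:
  assumes p [measurable]: "p \<in> borel_measurable borel"
    and p_reflect: "\<And>x w. p (reflect_pair x w) = reflect (p x) (p w)" "p (0, 0) = 0"
    and le1: "(\<integral>\<^sup>+v. exp (p v) \<partial>\<mu>) \<le> 1"
  shows "emeasure (driven_law reflect_pair (0, 0) \<mu> n) {w. x < p w} \<le> ennreal (exp (- x))"
proof (induction n arbitrary: x)
  case 0
  show ?case using p_reflect by (auto simp: indicator_def)
next
  case (Suc n)
  note [measurable_cong] = \<mu>(2)
  interpret \<nu>: prob_space "driven_law reflect_pair (0, 0) \<mu> (Suc n)"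
    using prob_space_driven_law[OF \<mu> reflect_pair_measurable] .
  show ?case
  proof (cases "x < 0")
    case True
    have "emeasure (driven_law reflect_pair (0, 0) \<mu> (Suc n)) {w. x < p w} \<le> ennreal 1"
      using \<nu>.emeasure_le_1 by simp
    also have "\<dots> \<le> ennreal (exp (- x))" using True by (intro ennreal_leI) simp
    finally show ?thesis .
  next
    case False
    have "emeasure (driven_law reflect_pair (0, 0) \<mu> (Suc n)) {w. x < p w} =
        (\<integral>\<^sup>+v. emeasure (driven_law reflect_pair (0, 0) \<mu> n) {w. reflect_pair v w \<in> {w. x < p w}} \<partial>\<mu>)"
      by (rule emeasure_driven_law_Suc[OF \<mu> reflect_pair_measurable]) measurable
    also have "\<dots> = (\<integral>\<^sup>+v. emeasure (driven_law reflect_pair (0, 0) \<mu> n) {w. x - p v < p w} \<partial>\<mu>)"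
      using False by (intro nn_integral_cong arg_cong2[of _ _ _ _ emeasure])
        (auto simp: p_reflect reflect_def)
    also have "\<dots> \<le> (\<integral>\<^sup>+v. ennreal (exp (- x)) * ennreal (exp (p v)) \<partial>\<mu>)"
    proof (intro nn_integral_mono)
      fix v
      show "emeasure (driven_law reflect_pair (0, 0) \<mu> n) {w. x - p v < p w}
          \<le> ennreal (exp (- x)) * ennreal (exp (p v))"
        using Suc.IH[of "x - p v"] by (simp add: ennreal_mult[symmetric] exp_add[symmetric])
    qed
    also have "\<dots> = ennreal (exp (- x)) * (\<integral>\<^sup>+v. exp (p v) \<partial>\<mu>)"
      by (rule nn_integral_cmult) measurable
    also have "\<dots> \<le> ennreal (exp (- x)) * 1"
      by (intro mult_left_mono le1) auto
    finally show ?thesis by simp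
  qed
qed

text \<open>The same induction with the function \<open>exp (- (r x + s y))\<close>, which is superharmonic for the step
  by the third moment hypothesis. Where a coordinate is negative that level is exceeded for free;
  there the one-dimensional inequality suffices because \<open>r\<close> and \<open>s\<close> do not exceed \<open>1\<close>.\<close>

lemma reflect_pair_joint_tail:
  assumes fst_le1: "(\<integral>\<^sup>+v. exp (fst v) \<partial>\<mu>) \<le> 1" and snd_le1: "(\<integral>\<^sup>+v. exp (snd v) \<partial>\<mu>) \<le> 1"
    and rs_le1: "(\<integral>\<^sup>+v. exp (r * fst v + s * snd v) \<partial>\<mu>) \<le> 1"
    and r: "0 \<le> r" "r \<le> 1" and s: "0 \<le> s" "s \<le> 1"
  shows "emeasure (driven_law reflect_pair (0, 0) \<mu> n) {w. x < fst w \<and> y < snd w}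
    \<le> ennreal (exp (- (r * x + s * y)))"
proof (induction n arbitrary: x y)
  case 0
  have "r * x + s * y \<le> 0" if "x < 0" "y < 0"
    using that r s by (simp add: add_nonpos_nonpos mult_nonneg_nonpos)
  moreover have "open {w :: real \<times> real. x < fst w \<and> y < snd w}"
    by (intro open_Collect_conj open_Collect_less continuous_intros)
  ultimately show ?case by (auto simp: indicator_def)
next
  case (Suc n)
  note [measurable_cong] = \<mu>(2)
  let ?\<nu> = "driven_law reflect_pair (0, 0) \<mu>"
  note rm = reflect_pair_measurable
  interpret \<nu>: prob_space "?\<nu> (Suc n)"
    using prob_space_driven_law[OF \<mu> rm] .
  have sets_\<nu> [simp]: "sets (?\<nu> k) = sets borel" for k
    using sets_driven_law[OF \<mu> rm] .
  have fst_tail: "emeasure (?\<nu> (Suc n)) {w. x < fst w} \<le> ennreal (exp (- x))" for x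
    using fst_le1 by (intro reflect_pair_tail) (auto simp: reflect_pair_def borel_prod[symmetric])
  have snd_tail: "emeasure (?\<nu> (Suc n)) {w. x < snd w} \<le> ennreal (exp (- x))" for x
    using snd_le1 by (intro reflect_pair_tail) (auto simp: reflect_pair_def borel_prod[symmetric])
  have open_half: "{w :: real \<times> real. x < fst w} \<in> sets borel" "{w :: real \<times> real. y < snd w} \<in> sets borel" for x y
    by (auto intro!: borel_open open_Collect_less continuous_intros)
  consider "x < 0" "y < 0" | "x < 0" "0 \<le> y" | "0 \<le> x" "y < 0" | "0 \<le> x" "0 \<le> y" by linarith
  then show ?case
  proof cases
    case 1
    then have "r * x + s * y \<le> 0" using r s by (simp add: add_nonpos_nonpos mult_nonneg_nonpos)
    then have "ennreal 1 \<le> ennreal (exp (- (r * x + s * y)))" by (intro ennreal_leI) simp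
    moreover have "emeasure (?\<nu> (Suc n)) {w. x < fst w \<and> y < snd w} \<le> ennreal 1"
      using \<nu>.emeasure_le_1 by (simp del: driven_law.simps)
    ultimately show ?thesis by (rule order_trans[rotated])
  next
    case 2
    have "emeasure (?\<nu> (Suc n)) {w. x < fst w \<and> y < snd w} \<le> emeasure (?\<nu> (Suc n)) {w. y < snd w}"
      using open_half by (intro emeasure_mono) auto
    also have "\<dots> \<le> ennreal (exp (- y))" by (rule snd_tail)
    also have "\<dots> \<le> ennreal (exp (- (r * x + s * y)))"
    proof -
      have "r * x \<le> 0" using 2 r by (simp add: mult_nonneg_nonpos)
      moreover have "s * y \<le> 1 * y" using 2 s by (intro mult_right_mono) auto
      ultimately show ?thesis by (intro ennreal_leI) simp
    qed
    finally show ?thesis .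
  next
    case 3
    have "emeasure (?\<nu> (Suc n)) {w. x < fst w \<and> y < snd w} \<le> emeasure (?\<nu> (Suc n)) {w. x < fst w}"
      using open_half by (intro emeasure_mono) auto
    also have "\<dots> \<le> ennreal (exp (- x))" by (rule fst_tail)
    also have "\<dots> \<le> ennreal (exp (- (r * x + s * y)))"
    proof -
      have "s * y \<le> 0" using 3 s by (simp add: mult_nonneg_nonpos)
      moreover have "r * x \<le> 1 * x" using 3 r by (intro mult_right_mono) auto
      ultimately show ?thesis by (intro ennreal_leI) simp
    qed
    finally show ?thesis .
  next
    case 4
    have "{w :: real \<times> real. x < fst w \<and> y < snd w} = {w. x < fst w} \<inter> {w. y < snd w}" by auto
    then have "{w :: real \<times> real. x < fst w \<and> y < snd w} \<in> sets borel"
      using open_half by (metis sets.Int)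
    then have "emeasure (?\<nu> (Suc n)) {w. x < fst w \<and> y < snd w} =
        (\<integral>\<^sup>+v. emeasure (?\<nu> n) {w. reflect_pair v w \<in> {w. x < fst w \<and> y < snd w}} \<partial>\<mu>)"
      by (rule emeasure_driven_law_Suc[OF \<mu> rm])
    also have "\<dots> = (\<integral>\<^sup>+v. emeasure (?\<nu> n) {w. x - fst v < fst w \<and> y - snd v < snd w} \<partial>\<mu>)"
      using 4 by (intro nn_integral_cong arg_cong2[of _ _ _ _ emeasure])
        (auto simp: reflect_pair_def reflect_def)
    also have "\<dots> \<le> (\<integral>\<^sup>+v. ennreal (exp (- (r * x + s * y))) * ennreal (exp (r * fst v + s * snd v)) \<partial>\<mu>)"
    proof (intro nn_integral_mono)
      fix v
      show "emeasure (?\<nu> n) {w. x - fst v < fst w \<and> y - snd v < snd w}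
          \<le> ennreal (exp (- (r * x + s * y))) * ennreal (exp (r * fst v + s * snd v))"
        using Suc.IH[of "x - fst v" "y - snd v"]
        by (simp add: ennreal_mult[symmetric] exp_add[symmetric] algebra_simps)
    qed
    also have "\<dots> = ennreal (exp (- (r * x + s * y))) * (\<integral>\<^sup>+v. exp (r * fst v + s * snd v) \<partial>\<mu>)"
      unfolding borel_prod[symmetric] using \<mu>(2)
      by (intro nn_integral_cmult) (auto simp: borel_prod[symmetric] cong: measurable_cong_sets)
    also have "\<dots> \<le> ennreal (exp (- (r * x + s * y))) * 1"
      by (intro mult_left_mono rs_le1) auto
    finally show ?thesis by simp
  qed
qed

end

section \<open>Exponential moments of Levy processes\<close>

definition exp_moment ::
  "'a measure \<Rightarrow> (real \<Rightarrow> 'a \<Rightarrow> 'b::euclidean_space) \<Rightarrow> real \<Rightarrow> 'b \<Rightarrow> ennreal" where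
  "exp_moment M Z t \<theta> = (\<integral>\<^sup>+\<omega>. ennreal (exp (\<theta> \<bullet> Z t \<omega>)) \<partial>M)"

lemma ennreal_power_le_1D:
  fixes b :: ennreal
  assumes "b ^ Suc m \<le> 1" shows "b \<le> 1"
proof (rule ccontr)
  assume "\<not> b \<le> 1"
  then have b: "1 \<le> b" by simp
  have "b * 1 \<le> b * b ^ m"
    using b by (intro mult_left_mono) (auto simp: one_le_power)
  with assms \<open>\<not> b \<le> 1\<close> show False by (simp add: order_trans)
qed

lemma ennreal_power_eq_1D:
  fixes b :: ennreal
  assumes "b ^ Suc m = 1" shows "b = 1"
proof (rule antisym)
  show le: "b \<le> 1" using assms by (simp add: ennreal_power_le_1D[of b m] del: power_Suc)
  have "b * b ^ m \<le> b * 1"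
    using le by (intro mult_left_mono power_le_one) auto
  with assms show "1 \<le> b" by simp
qed

lemma cadlag_open_dyadic:
  assumes f: "cadlag f" and t: "0 \<le> t" and U: "open U" "f t \<in> U"
  obtains k n :: nat where "f (real k / 2 ^ n) \<in> U"
proof -
  have "(f \<longlongrightarrow> f t) (at_right t)" using f t by (auto simp: cadlag_def)
  then have "eventually (\<lambda>s. f s \<in> U) (at_right t)" using U by (rule topological_tendstoD)
  then obtain b where b: "t < b" "\<And>s. t < s \<Longrightarrow> s < b \<Longrightarrow> f s \<in> U"
    by (auto simp: eventually_at_right_field)
  obtain n where n: "1 / 2 ^ n < b - t"
    using b(1) real_arch_pow_inv[of "b - t" "1/2"] by (auto simp: power_one_over)
  define k where "k = nat (\<lfloor>t * 2 ^ n\<rfloor> + 1)"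
  have k: "t * 2 ^ n < real k" "real k \<le> t * 2 ^ n + 1"
    using t unfolding k_def by (auto simp: of_nat_nat)
  have "t < real k / 2 ^ n" using k(1) by (simp add: field_simps)
  moreover have "real k / 2 ^ n \<le> t + 1 / 2 ^ n" using k(2) by (simp add: field_simps)
  ultimately have "f (real k / 2 ^ n) \<in> U" using n by (intro b(2)) auto
  then show thesis by (rule that)
qed

context
  fixes M :: "'a measure" and Z :: "real \<Rightarrow> 'a \<Rightarrow> 'b::euclidean_space"
  assumes levy: "levy_process M Z"
begin

lemma levy_prob_space: "prob_space M"
  using levy by (simp add: levy_process_def)

lemma levy_measurable: "0 \<le> t \<Longrightarrow> Z t \<in> borel_measurable M"
  using levy by (simp add: levy_process_def)

lemma levy_0: "AE \<omega> in M. Z 0 \<omega> = 0"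
  using levy by (simp add: levy_process_def)

lemma levy_cadlag: "\<omega> \<in> space M \<Longrightarrow> cadlag (\<lambda>t. Z t \<omega>)"
  using levy by (simp add: levy_process_def)

lemma levy_increment_law:
  assumes "0 \<le> h"
  shows "distr M borel (\<lambda>\<omega>. Z (real (Suc i) * h) \<omega> - Z (real i * h) \<omega>) = distr M borel (Z h)"
proof -
  have "distr M borel (\<lambda>\<omega>. Z (real i * h + h) \<omega> - Z (real i * h) \<omega>) = distr M borel (Z h)"
    using levy assms by (auto simp: levy_process_def)
  then show ?thesis by (simp add: algebra_simps)
qed

lemma levy_increments_indep:
  assumes "0 \<le> h"
  shows "prob_space.indep_vars M (\<lambda>_. borel)
    (\<lambda>i \<omega>. Z (real (Suc i) * h) \<omega> - Z (real i * h) \<omega>) {..<n}"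
proof -
  have "\<forall>n (t :: nat \<Rightarrow> real). 0 \<le> t 0 \<and> (\<forall>i<n. t i \<le> t (Suc i)) \<longrightarrow>
      prob_space.indep_vars M (\<lambda>_. borel) (\<lambda>i \<omega>. Z (t (Suc i)) \<omega> - Z (t i) \<omega>) {..<n}"
    using levy by (simp add: levy_process_def)
  from this[rule_format, of "\<lambda>i. real i * h" n] show ?thesis
    using assms by (simp add: mult_right_mono del: of_nat_Suc)
qed

text \<open>The increments are listed backwards in time, to match the duality for reflected walks.\<close>

lemma levy_reversed_increments_indep:
  assumes "0 \<le> h"
  shows "prob_space.indep_vars M (\<lambda>_. borel)
    (\<lambda>i \<omega>. Z (real (n - i) * h) \<omega> - Z (real (n - Suc i) * h) \<omega>) {..<n}"
proof -
  interpret prob_space M by (rule levy_prob_space)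
  let ?X = "\<lambda>i \<omega>. Z (real (Suc i) * h) \<omega> - Z (real i * h) \<omega>"
  let ?K = "\<lambda>j. {n - Suc j}"
  have "indep_vars (\<lambda>j. \<Pi>\<^sub>M i\<in>?K j. borel) (\<lambda>j \<omega>. restrict (\<lambda>i. ?X i \<omega>) (?K j)) {..<n}"
    using assms by (intro indep_vars_restrict[OF levy_increments_indep[where n = n]])
      (auto simp: disjoint_family_on_def)
  then have "indep_vars (\<lambda>_. borel) (\<lambda>j \<omega>. (restrict (\<lambda>i. ?X i \<omega>) (?K j)) (n - Suc j)) {..<n}"
    by (rule indep_vars_compose2) (auto intro: measurable_component_singleton)
  also have "?this \<longleftrightarrow> ?thesis"
    by (intro indep_vars_cong) (auto simp: Suc_diff_Suc)
  finally show ?thesis .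
qed

lemma sum_reversed_increments:
  assumes "k \<le> n"
  shows "(\<Sum>i\<in>{n - k..<n}. Z (real (n - i) * h) \<omega> - Z (real (n - Suc i) * h) \<omega>) = Z (real k * h) \<omega> - Z 0 \<omega>"
  using assms
proof (induction k)
  case (Suc k)
  have e: "{n - Suc k..<n} = insert (n - Suc k) {n - k..<n}" using Suc.prems by auto
  have i: "n - (n - Suc k) = Suc k" "n - Suc (n - Suc k) = k" using Suc.prems by auto
  show ?case using Suc Suc.prems by (subst e) (simp add: i del: of_nat_Suc)
qed simp

lemma exp_moment_power:
  assumes h: "0 \<le> h"
  shows "exp_moment M Z (real n * h) \<theta> = exp_moment M Z h \<theta> ^ n"
proof -
  interpret prob_space M by (rule levy_prob_space)
  let ?X = "\<lambda>i \<omega>. Z (real (Suc i) * h) \<omega> - Z (real i * h) \<omega>"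
  have X: "(\<lambda>\<omega>. ?X i \<omega>) \<in> borel_measurable M" for i
    using h by (intro borel_measurable_diff levy_measurable) auto
  have one: "(\<integral>\<^sup>+\<omega>. ennreal (exp (\<theta> \<bullet> ?X i \<omega>)) \<partial>M) = exp_moment M Z h \<theta>" for i
  proof -
    have "(\<integral>\<^sup>+\<omega>. ennreal (exp (\<theta> \<bullet> ?X i \<omega>)) \<partial>M) =
        (\<integral>\<^sup>+x. ennreal (exp (\<theta> \<bullet> x)) \<partial>distr M borel (\<lambda>\<omega>. ?X i \<omega>))"
      using X by (subst nn_integral_distr) auto
    also have "\<dots> = exp_moment M Z h \<theta>"
      unfolding levy_increment_law[OF h] exp_moment_def
      using levy_measurable[OF h] by (subst nn_integral_distr) auto
    finally show ?thesis .
  qed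
  have tele: "Z (real n * h) \<omega> - Z 0 \<omega> = (\<Sum>i<n. ?X i \<omega>)" for \<omega>
    using sum_lessThan_telescope[of "\<lambda>i. Z (real i * h) \<omega>" n] by simp
  have "exp_moment M Z (real n * h) \<theta> = (\<integral>\<^sup>+\<omega>. (\<Prod>i<n. ennreal (exp (\<theta> \<bullet> ?X i \<omega>))) \<partial>M)"
    unfolding exp_moment_def
  proof (intro nn_integral_cong_AE, use levy_0 in eventually_elim)
    fix \<omega>
    assume "Z 0 \<omega> = 0"
    then have "\<theta> \<bullet> Z (real n * h) \<omega> = (\<Sum>i<n. \<theta> \<bullet> ?X i \<omega>)"
      using tele[of \<omega>] by (simp add: inner_sum_right)
    then show "ennreal (exp (\<theta> \<bullet> Z (real n * h) \<omega>)) = (\<Prod>i<n. ennreal (exp (\<theta> \<bullet> ?X i \<omega>)))"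
      by (simp add: exp_sum prod_ennreal)
  qed
  also have "\<dots> = (\<Prod>i<n. \<integral>\<^sup>+\<omega>. ennreal (exp (\<theta> \<bullet> ?X i \<omega>)) \<partial>M)"
    by (intro indep_vars_nn_integral indep_vars_compose2[OF levy_increments_indep[OF h]]) auto
  also have "\<dots> = exp_moment M Z h \<theta> ^ n" unfolding one by simp
  finally show ?thesis .
qed

lemma exp_moment_dyadic_le_1:
  assumes "exp_moment M Z 1 \<theta> \<le> 1"
  shows "exp_moment M Z (1 / 2 ^ n) \<theta> \<le> 1"
proof -
  obtain m where m: "2 ^ n = Suc m" by (metis not0_implies_Suc power_not_zero zero_neq_numeral)
  have "exp_moment M Z (1 / 2 ^ n) \<theta> ^ Suc m = exp_moment M Z 1 \<theta>"
    using exp_moment_power[of "1 / 2 ^ n" "2 ^ n" \<theta>] unfolding m[symmetric] by simp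
  with assms show ?thesis by (simp add: ennreal_power_le_1D[of _ m] del: power_Suc)
qed

lemma exp_moment_dyadic_eq_1:
  assumes "exp_moment M Z 1 \<theta> = 1"
  shows "exp_moment M Z (real k / 2 ^ n) \<theta> = 1"
proof -
  obtain m where m: "2 ^ n = Suc m" by (metis not0_implies_Suc power_not_zero zero_neq_numeral)
  have "exp_moment M Z (1 / 2 ^ n) \<theta> ^ Suc m = exp_moment M Z 1 \<theta>"
    using exp_moment_power[of "1 / 2 ^ n" "2 ^ n" \<theta>] unfolding m[symmetric] by simp
  with assms have "exp_moment M Z (1 / 2 ^ n) \<theta> = 1" by (simp add: ennreal_power_eq_1D[of _ m] del: power_Suc)
  then show ?thesis using exp_moment_power[of "1 / 2 ^ n" k \<theta>] by simp
qed

text \<open>The defect in the inequality between arithmetic and geometric means, integrated.\<close>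

lemma exp_moment_midpoint:
  assumes t: "0 \<le> t"
  shows "exp_moment M Z t u + exp_moment M Z t v =
    2 * exp_moment M Z t ((1/2) *\<^sub>R (u + v)) +
    (\<integral>\<^sup>+\<omega>. ennreal ((exp (u \<bullet> Z t \<omega> / 2) - exp (v \<bullet> Z t \<omega> / 2))\<^sup>2) \<partial>M)"
proof -
  note [measurable] = levy_measurable[OF t]
  have e: "exp (x / 2) ^ 2 = exp x" for x :: real
    by (simp add: power2_eq_square exp_add[symmetric])
  have "ennreal (exp (u \<bullet> z)) + ennreal (exp (v \<bullet> z)) =
      2 * ennreal (exp (((1/2) *\<^sub>R (u + v)) \<bullet> z)) +
      ennreal ((exp (u \<bullet> z / 2) - exp (v \<bullet> z / 2))\<^sup>2)" for z
  proof -
    have "exp (((1/2) *\<^sub>R (u + v)) \<bullet> z) = exp (u \<bullet> z / 2) * exp (v \<bullet> z / 2)"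
      by (simp add: exp_add[symmetric] inner_add_left field_simps)
    then have "exp (u \<bullet> z) + exp (v \<bullet> z) = 2 * exp (((1/2) *\<^sub>R (u + v)) \<bullet> z) +
        (exp (u \<bullet> z / 2) - exp (v \<bullet> z / 2))\<^sup>2"
      by (simp add: power2_diff e algebra_simps)
    moreover have "(2::ennreal) = ennreal 2" by simp
    ultimately show ?thesis
      by (simp only: ennreal_mult[symmetric] ennreal_plus[symmetric] exp_ge_zero zero_le_power2
          zero_le_numeral mult_nonneg_nonneg)
  qed
  then have "(\<integral>\<^sup>+\<omega>. ennreal (exp (u \<bullet> Z t \<omega>)) + ennreal (exp (v \<bullet> Z t \<omega>)) \<partial>M) =
      (\<integral>\<^sup>+\<omega>. 2 * ennreal (exp (((1/2) *\<^sub>R (u + v)) \<bullet> Z t \<omega>)) +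
        ennreal ((exp (u \<bullet> Z t \<omega> / 2) - exp (v \<bullet> Z t \<omega> / 2))\<^sup>2) \<partial>M)"
    by (intro nn_integral_cong)
  then show ?thesis
    unfolding exp_moment_def by (simp add: nn_integral_add nn_integral_cmult del: inner_scaleR_left)
qed

text \<open>Equality at the midpoint would hold at all dyadic times, because moments at those times are
  powers or roots of the moment at time \<open>1\<close>. It would force the two linear functionals to agree
  almost surely at each dyadic time, hence by right-continuity along the whole path.\<close>

lemma exp_moment_midpoint_less_1:
  assumes u: "exp_moment M Z 1 u = 1" and v: "exp_moment M Z 1 v = 1"
    and neq: "\<not> (AE \<omega> in M. \<forall>t\<ge>0. u \<bullet> Z t \<omega> = v \<bullet> Z t \<omega>)"
  shows "exp_moment M Z 1 ((1/2) *\<^sub>R (u + v)) < 1"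
proof (rule ccontr)
  let ?w = "(1/2) *\<^sub>R (u + v)"
  assume "\<not> ?thesis"
  moreover have "exp_moment M Z 1 ?w \<le> 1"
  proof -
    have "2 * exp_moment M Z 1 ?w \<le> exp_moment M Z 1 u + exp_moment M Z 1 v"
      by (simp add: exp_moment_midpoint)
    then have "2 * exp_moment M Z 1 ?w \<le> 2 * 1" by (simp add: u v)
    then show ?thesis by (subst (asm) ennreal_mult_le_mult_iff) auto
  qed
  ultimately have w: "exp_moment M Z 1 ?w = 1" by simp
  have "AE \<omega> in M. u \<bullet> Z (real k / 2 ^ n) \<omega> = v \<bullet> Z (real k / 2 ^ n) \<omega>" for k n :: nat
  proof -
    let ?t = "real k / 2 ^ n"
    have t: "0 \<le> ?t" by simp
    note [measurable] = levy_measurable[OF t]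
    have "(\<integral>\<^sup>+\<omega>. ennreal ((exp (u \<bullet> Z ?t \<omega> / 2) - exp (v \<bullet> Z ?t \<omega> / 2))\<^sup>2) \<partial>M) = 0"
      using exp_moment_midpoint[OF t, of u v] exp_moment_dyadic_eq_1[OF u, of k n]
        exp_moment_dyadic_eq_1[OF v, of k n] exp_moment_dyadic_eq_1[OF w, of k n]
      by (simp add: ennreal_add_left_cancel[of 2 0, simplified])
    then have "AE \<omega> in M. ennreal ((exp (u \<bullet> Z ?t \<omega> / 2) - exp (v \<bullet> Z ?t \<omega> / 2))\<^sup>2) = 0"
      by (subst (asm) nn_integral_0_iff_AE) auto
    then show ?thesis by eventually_elim (auto simp: ennreal_eq_0_iff)
  qed
  then have "AE \<omega> in M. \<forall>k n :: nat. u \<bullet> Z (real k / 2 ^ n) \<omega> = v \<bullet> Z (real k / 2 ^ n) \<omega>"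
    by (simp add: AE_all_countable)
  then have "AE \<omega> in M. \<forall>t\<ge>0. u \<bullet> Z t \<omega> = v \<bullet> Z t \<omega>"
    using AE_space
  proof eventually_elim
    case (elim \<omega>)
    show ?case
    proof (intro allI impI, rule ccontr)
      fix t :: real
      assume t: "0 \<le> t" "u \<bullet> Z t \<omega> \<noteq> v \<bullet> Z t \<omega>"
      have "open {z. u \<bullet> z \<noteq> v \<bullet> z}"
        by (intro open_Collect_neq continuous_intros)
      from cadlag_open_dyadic[OF levy_cadlag[OF elim(2)] t(1) this] t(2) elim(1)
      show False by auto
    qed
  qed
  with neq show False by contradiction
qed

lemma exp_moment_convex:
  assumes t: "0 \<le> t" and l: "0 \<le> l" "l \<le> 1"
  shows "exp_moment M Z t ((1 - l) *\<^sub>R u + l *\<^sub>R v) \<le>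
    ennreal (1 - l) * exp_moment M Z t u + ennreal l * exp_moment M Z t v"
proof -
  note [measurable] = levy_measurable[OF t]
  have "exp_moment M Z t ((1 - l) *\<^sub>R u + l *\<^sub>R v) \<le>
      (\<integral>\<^sup>+\<omega>. ennreal (1 - l) * ennreal (exp (u \<bullet> Z t \<omega>)) + ennreal l * ennreal (exp (v \<bullet> Z t \<omega>)) \<partial>M)"
    unfolding exp_moment_def
  proof (intro nn_integral_mono)
    fix \<omega>
    have "exp ((1 - l) *\<^sub>R (u \<bullet> Z t \<omega>) + l *\<^sub>R (v \<bullet> Z t \<omega>)) \<le>
        (1 - l) * exp (u \<bullet> Z t \<omega>) + l * exp (v \<bullet> Z t \<omega>)"
      using l by (intro convex_onD[OF exp_convex]) auto
    then show "ennreal (exp (((1 - l) *\<^sub>R u + l *\<^sub>R v) \<bullet> Z t \<omega>)) \<le>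
        ennreal (1 - l) * ennreal (exp (u \<bullet> Z t \<omega>)) + ennreal l * ennreal (exp (v \<bullet> Z t \<omega>))"
      using l by (simp add: inner_add_left ennreal_mult[symmetric] ennreal_plus[symmetric] ennreal_leI
          del: ennreal_plus)
  qed
  also have "\<dots> = ennreal (1 - l) * exp_moment M Z t u + ennreal l * exp_moment M Z t v"
    unfolding exp_moment_def by (subst nn_integral_add) (auto simp: nn_integral_cmult)
  finally show ?thesis .
qed

end

section \<open>Exceedance of levels by linear functionals\<close>

text \<open>The strict inequality makes exceedance stable under small shifts of time to the right, so that
  dyadic times detect it.\<close>

definition exceeds :: "(real \<Rightarrow> 'a \<Rightarrow> 'b::real_inner) \<Rightarrow> 'b \<Rightarrow> real \<Rightarrow> 'a \<Rightarrow> bool" where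
  "exceeds Z u x \<omega> \<longleftrightarrow> (\<exists>t\<ge>0. x < u \<bullet> Z t \<omega>)"

definition exceeds_on_grid ::
  "(real \<Rightarrow> 'a \<Rightarrow> 'b::real_inner) \<Rightarrow> real \<Rightarrow> nat \<Rightarrow> 'b \<Rightarrow> real \<Rightarrow> 'a \<Rightarrow> bool" where
  "exceeds_on_grid Z h n u x \<omega> \<longleftrightarrow> (\<exists>k\<le>n. x < u \<bullet> Z (real k * h) \<omega>)"

lemma exceedsI: "0 \<le> t \<Longrightarrow> x < u \<bullet> Z t \<omega> \<Longrightarrow> exceeds Z u x \<omega>"
  unfolding exceeds_def by blast

lemma exceeds_on_grid_imp_exceeds:
  "0 \<le> h \<Longrightarrow> exceeds_on_grid Z h n u x \<omega> \<Longrightarrow> exceeds Z u x \<omega>"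
  unfolding exceeds_on_grid_def by (auto intro: exceedsI[rotated])

context
  fixes M :: "'a measure" and Z :: "real \<Rightarrow> 'a \<Rightarrow> 'b::euclidean_space"
  assumes levy: "levy_process M Z"
begin

lemma exceeds_on_grid_iff_driven:
  assumes "Z 0 \<omega> = 0"
  shows "exceeds_on_grid Z h n u x \<omega> \<longleftrightarrow>
    x < driven reflect 0 (\<lambda>i. u \<bullet> (Z (real (n - i) * h) \<omega> - Z (real (n - Suc i) * h) \<omega>)) n"
proof -
  have "(\<Sum>i\<in>{n - k..<n}. u \<bullet> (Z (real (n - i) * h) \<omega> - Z (real (n - Suc i) * h) \<omega>)) =
      u \<bullet> Z (real k * h) \<omega>" if "k \<le> n" for k
    using sum_reversed_increments[OF levy that, of h \<omega>] assms by (simp add: inner_sum_right[symmetric])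
  then show ?thesis
    unfolding exceeds_on_grid_def less_driven_reflect_iff by auto
qed

lemma levy_reversed_increment_law:
  assumes h: "0 \<le> h" and i: "i < n"
  shows "distr M borel (\<lambda>\<omega>. Z (real (n - i) * h) \<omega> - Z (real (n - Suc i) * h) \<omega>) = distr M borel (Z h)"
  using levy_increment_law[OF levy h, of "n - Suc i"] i by (simp add: Suc_diff_Suc del: of_nat_Suc)

lemma emeasure_driven_levy:
  fixes p :: "'b \<Rightarrow> 'c::second_countable_topology"
    and g :: "'c \<Rightarrow> 's::topological_space \<Rightarrow> 's"
  assumes h: "0 \<le> h"
    and p: "p \<in> borel_measurable borel"
    and g: "case_prod g \<in> borel \<Otimes>\<^sub>M borel \<rightarrow>\<^sub>M borel"
    and A: "A \<in> sets borel"
  shows "emeasure M {\<omega> \<in> space M.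
      driven g s (\<lambda>i. p (Z (real (n - i) * h) \<omega> - Z (real (n - Suc i) * h) \<omega>)) n \<in> A} =
    emeasure (driven_law g s (distr M borel (\<lambda>\<omega>. p (Z h \<omega>))) n) A" (is ?E)
    and "{\<omega> \<in> space M.
      driven g s (\<lambda>i. p (Z (real (n - i) * h) \<omega> - Z (real (n - Suc i) * h) \<omega>)) n \<in> A} \<in> sets M" (is ?M)
proof -
  interpret prob_space M by (rule levy_prob_space[OF levy])
  let ?X = "\<lambda>i \<omega>. Z (real (n - i) * h) \<omega> - Z (real (n - Suc i) * h) \<omega>"
  have X: "?X i \<in> borel_measurable M" for i
    using h by (intro borel_measurable_diff levy_measurable[OF levy]) auto
  have pZ: "(\<lambda>\<omega>. p (Z h \<omega>)) \<in> borel_measurable M"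
    by (rule measurable_compose[OF levy_measurable[OF levy h] p])
  have pX: "(\<lambda>\<omega>. p (?X i \<omega>)) \<in> borel_measurable M" for i
    by (rule measurable_compose[OF X p])
  have ind: "indep_vars (\<lambda>_. borel) (\<lambda>i \<omega>. p (?X i \<omega>)) {..<n}"
    using p by (intro indep_vars_compose2[OF levy_reversed_increments_indep[OF levy h]])
  have law: "distr M borel (\<lambda>\<omega>. p (?X i \<omega>)) = distr M borel (\<lambda>\<omega>. p (Z h \<omega>))" if "i < n" for i
  proof -
    have "distr M borel (\<lambda>\<omega>. p (?X i \<omega>)) = distr (distr M borel (?X i)) borel p"
      using X p by (subst distr_distr) (auto simp: comp_def)
    also have "\<dots> = distr M borel (\<lambda>\<omega>. p (Z h \<omega>))"
      unfolding levy_reversed_increment_law[OF h that]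
      using levy_measurable[OF levy h] p by (subst distr_distr) (auto simp: comp_def)
    finally show ?thesis .
  qed
  let ?W = "\<lambda>\<omega>. driven g s (\<lambda>i. p (?X i \<omega>)) n"
  have W: "?W \<in> borel_measurable M"
  proof -
    have "(\<lambda>\<omega>. driven g s (restrict (\<lambda>i. p (?X i \<omega>)) {..<n}) n) \<in> borel_measurable M"
      by (rule measurable_compose[OF measurable_restrict driven_measurable[OF g order_refl]]) (rule pX)
    also have "(\<lambda>\<omega>. driven g s (restrict (\<lambda>i. p (?X i \<omega>)) {..<n}) n) = ?W"
      by (intro ext driven_cong) simp
    finally show ?thesis .
  qed
  have eq: "{\<omega> \<in> space M. ?W \<omega> \<in> A} = ?W -` A \<inter> space M" by auto
  show ?M unfolding eq using W A by (rule measurable_sets)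
  have "emeasure M (?W -` A \<inter> space M) = emeasure (distr M borel ?W) A"
    using W A by (simp add: emeasure_distr)
  also have "distr M borel ?W = driven_law g s (distr M borel (\<lambda>\<omega>. p (Z h \<omega>))) n"
    using pZ ind law
    by (intro distr_driven[OF _ _ g] prob_space_axioms prob_space_distr) auto
  finally show ?E unfolding eq .
qed

lemma exceeds_on_grid_measurable [measurable]:
  assumes "0 \<le> h"
  shows "Measurable.pred M (exceeds_on_grid Z h n u x)"
proof -
  have [measurable]: "Z (real k * h) \<in> borel_measurable M" for k
    using assms by (intro levy_measurable[OF levy]) auto
  show ?thesis unfolding exceeds_on_grid_def by measurable
qed

lemma emeasure_exceeds_on_grid:
  assumes h: "0 \<le> h"
  shows "emeasure M {\<omega> \<in> space M. exceeds_on_grid Z h n u x \<omega>} =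
    emeasure (driven_law reflect 0 (distr M borel (\<lambda>\<omega>. u \<bullet> Z h \<omega>)) n) {x<..}"
proof -
  note grid = emeasure_driven_levy[OF h, of "\<lambda>z. u \<bullet> z" reflect "{x<..}" 0 n]
  have "emeasure M {\<omega> \<in> space M. exceeds_on_grid Z h n u x \<omega>} = emeasure M {\<omega> \<in> space M.
      driven reflect 0 (\<lambda>i. u \<bullet> (Z (real (n - i) * h) \<omega> - Z (real (n - Suc i) * h) \<omega>)) n \<in> {x<..}}"
  proof (rule emeasure_eq_AE)
    show "AE \<omega> in M. (\<omega> \<in> {\<omega> \<in> space M. exceeds_on_grid Z h n u x \<omega>}) = (\<omega> \<in> {\<omega> \<in> space M.
        driven reflect 0 (\<lambda>i. u \<bullet> (Z (real (n - i) * h) \<omega> - Z (real (n - Suc i) * h) \<omega>)) n \<in> {x<..}})"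
      using levy_0[OF levy] by eventually_elim (simp add: exceeds_on_grid_iff_driven)
  qed (use exceeds_on_grid_measurable[OF h] grid(2) reflect_measurable in \<open>auto simp: pred_def\<close>)
  then show ?thesis using grid(1) reflect_measurable by simp
qed

lemma emeasure_exceeds_on_grid_both:
  assumes h: "0 \<le> h"
  shows "emeasure M {\<omega> \<in> space M. exceeds_on_grid Z h n u x \<omega> \<and> exceeds_on_grid Z h n v y \<omega>} =
    emeasure (driven_law reflect_pair (0, 0) (distr M borel (\<lambda>\<omega>. (u \<bullet> Z h \<omega>, v \<bullet> Z h \<omega>))) n)
      {w. x < fst w \<and> y < snd w}"
proof -
  let ?A = "{w :: real \<times> real. x < fst w \<and> y < snd w}"
  have "open ?A" by (intro open_Collect_conj open_Collect_less continuous_intros)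
  then have A: "?A \<in> sets borel" by simp
  have p: "(\<lambda>z. (u \<bullet> z, v \<bullet> z)) \<in> borel_measurable (borel :: 'b measure)"
    by (intro borel_measurable_continuous_onI continuous_intros)
  note grid = emeasure_driven_levy[OF h p reflect_pair_measurable A, of "(0, 0)" n]
  let ?W = "\<lambda>\<omega>. driven reflect_pair (0, 0)
    (\<lambda>i. (u \<bullet> (Z (real (n - i) * h) \<omega> - Z (real (n - Suc i) * h) \<omega>),
          v \<bullet> (Z (real (n - i) * h) \<omega> - Z (real (n - Suc i) * h) \<omega>))) n"
  have "emeasure M {\<omega> \<in> space M. exceeds_on_grid Z h n u x \<omega> \<and> exceeds_on_grid Z h n v y \<omega>} =
      emeasure M {\<omega> \<in> space M. ?W \<omega> \<in> ?A}"
  proof (rule emeasure_eq_AE)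
    show "AE \<omega> in M. (\<omega> \<in> {\<omega> \<in> space M. exceeds_on_grid Z h n u x \<omega> \<and> exceeds_on_grid Z h n v y \<omega>}) =
        (\<omega> \<in> {\<omega> \<in> space M. ?W \<omega> \<in> ?A})"
      using levy_0[OF levy]
      by eventually_elim (simp add: exceeds_on_grid_iff_driven driven_reflect_pair)
    show "{\<omega> \<in> space M. exceeds_on_grid Z h n u x \<omega> \<and> exceeds_on_grid Z h n v y \<omega>} \<in> sets M"
      using h by measurable
  qed (use grid(2) in auto)
  then show ?thesis using grid(1) by simp
qed

lemma exceeds_iff_dyadic:
  assumes "\<omega> \<in> space M"
  shows "exceeds Z u x \<omega> \<longleftrightarrow> (\<exists>k n :: nat. x < u \<bullet> Z (real k / 2 ^ n) \<omega>)"
proof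
  assume "exceeds Z u x \<omega>"
  then obtain t where t: "0 \<le> t" "x < u \<bullet> Z t \<omega>" by (auto simp: exceeds_def)
  have "open {z. x < u \<bullet> z}" by (intro open_Collect_less continuous_intros)
  from cadlag_open_dyadic[OF levy_cadlag[OF levy assms] t(1) this] t(2)
  obtain k n :: nat where "x < u \<bullet> Z (real k / 2 ^ n) \<omega>" by auto
  then show "\<exists>k n :: nat. x < u \<bullet> Z (real k / 2 ^ n) \<omega>" by (intro exI)
qed (auto intro: exceedsI[rotated])

lemma exceeds_measurable: "{\<omega> \<in> space M. exceeds Z u x \<omega>} \<in> sets M"
proof -
  have [measurable]: "Z (real k / 2 ^ n) \<in> borel_measurable M" for k n :: nat
    by (intro levy_measurable[OF levy]) auto
  have "{\<omega> \<in> space M. exceeds Z u x \<omega>} = {\<omega> \<in> space M. \<exists>k n :: nat. x < u \<bullet> Z (real k / 2 ^ n) \<omega>}"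
    by (intro Collect_cong conj_cong refl exceeds_iff_dyadic)
  also have "\<dots> \<in> sets M" by measurable
  finally show ?thesis .
qed

lemma exceeds_on_dyadic_grid_mono:
  assumes "exceeds_on_grid Z (1 / 2 ^ m) (m * 2 ^ m) u x \<omega>" "m \<le> n"
  shows "exceeds_on_grid Z (1 / 2 ^ n) (n * 2 ^ n) u x \<omega>"
proof -
  obtain k where k: "k \<le> m * 2 ^ m" "x < u \<bullet> Z (real k / 2 ^ m) \<omega>"
    using assms(1) by (auto simp: exceeds_on_grid_def)
  have e: "(2::nat) ^ n = 2 ^ m * 2 ^ (n - m)" "(2::real) ^ n = 2 ^ m * 2 ^ (n - m)"
    using assms(2) by (auto simp: power_add[symmetric])
  have "k * 2 ^ (n - m) \<le> (m * 2 ^ m) * 2 ^ (n - m)" using k(1) by (intro mult_right_mono) auto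
  also have "\<dots> \<le> n * 2 ^ n" using assms(2) by (simp add: e mult.assoc)
  finally have "k * 2 ^ (n - m) \<le> n * 2 ^ n" .
  moreover have "real (k * 2 ^ (n - m)) * (1 / 2 ^ n) = real k / 2 ^ m"
    by (simp add: e)
  ultimately show ?thesis
    using k(2) unfolding exceeds_on_grid_def by (intro exI[of _ "k * 2 ^ (n - m)"]) (simp only: simp_thms)
qed

lemma exceeds_iff_dyadic_grid:
  assumes "\<omega> \<in> space M"
  shows "exceeds Z u x \<omega> \<longleftrightarrow> (\<exists>n. exceeds_on_grid Z (1 / 2 ^ n) (n * 2 ^ n) u x \<omega>)"
proof
  assume "exceeds Z u x \<omega>"
  then obtain k m where km: "x < u \<bullet> Z (real k / 2 ^ m) \<omega>"
    using exceeds_iff_dyadic[OF assms] by auto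
  define n where "n = max k m"
  have e: "(2::real) ^ n = 2 ^ m * 2 ^ (n - m)"
    by (simp add: n_def power_add[symmetric])
  have "k * 2 ^ (n - m) \<le> n * 2 ^ n" by (intro mult_mono power_increasing) (auto simp: n_def)
  moreover have "real (k * 2 ^ (n - m)) * (1 / 2 ^ n) = real k / 2 ^ m"
    by (simp add: e)
  ultimately have "exceeds_on_grid Z (1 / 2 ^ n) (n * 2 ^ n) u x \<omega>"
    using km unfolding exceeds_on_grid_def by (intro exI[of _ "k * 2 ^ (n - m)"]) (simp only: simp_thms)
  then show "\<exists>n. exceeds_on_grid Z (1 / 2 ^ n) (n * 2 ^ n) u x \<omega>" ..
qed (auto intro: exceeds_on_grid_imp_exceeds[rotated])

text \<open>The grids of mesh \<open>1 / 2\<^sup>n\<close> on \<open>[0, n]\<close> exhaust the dyadic times, and the bound for reflected walks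
  does not depend on the number of steps.\<close>

lemma exceeds_both_bound:
  assumes u: "exp_moment M Z 1 u \<le> 1" and v: "exp_moment M Z 1 v \<le> 1"
    and uv: "exp_moment M Z 1 (r *\<^sub>R u + s *\<^sub>R v) \<le> 1"
    and r: "0 \<le> r" "r \<le> 1" and s: "0 \<le> s" "s \<le> 1"
  shows "measure M {\<omega> \<in> space M. exceeds Z u x \<omega> \<and> exceeds Z v y \<omega>} \<le> exp (- (r * x + s * y))"
proof -
  interpret prob_space M by (rule levy_prob_space[OF levy])
  define E where "E n = {\<omega> \<in> space M. exceeds_on_grid Z (1 / 2 ^ n) (n * 2 ^ n) u x \<omega> \<and>
      exceeds_on_grid Z (1 / 2 ^ n) (n * 2 ^ n) v y \<omega>}" for n :: nat
  have E_sets: "E n \<in> sets M" for n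
    unfolding E_def by measurable
  have inc: "incseq E"
    unfolding incseq_def E_def using exceeds_on_dyadic_grid_mono by auto
  have Un: "(\<Union>n. E n) = {\<omega> \<in> space M. exceeds Z u x \<omega> \<and> exceeds Z v y \<omega>}"
  proof (intro set_eqI iffI)
    fix \<omega> assume "\<omega> \<in> {\<omega> \<in> space M. exceeds Z u x \<omega> \<and> exceeds Z v y \<omega>}"
    then obtain m n where "\<omega> \<in> space M" "exceeds_on_grid Z (1 / 2 ^ m) (m * 2 ^ m) u x \<omega>"
        "exceeds_on_grid Z (1 / 2 ^ n) (n * 2 ^ n) v y \<omega>"
      using exceeds_iff_dyadic_grid by auto
    then have "\<omega> \<in> E (max m n)"
      unfolding E_def using exceeds_on_dyadic_grid_mono by auto
    then show "\<omega> \<in> (\<Union>n. E n)" by auto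
  next
    fix \<omega> assume "\<omega> \<in> (\<Union>n. E n)"
    then show "\<omega> \<in> {\<omega> \<in> space M. exceeds Z u x \<omega> \<and> exceeds Z v y \<omega>}"
      using exceeds_iff_dyadic_grid by (auto simp: E_def)
  qed
  have le: "measure M (E n) \<le> exp (- (r * x + s * y))" for n
  proof -
    let ?h = "1 / 2 ^ n :: real"
    note [measurable] = levy_measurable[OF levy, of ?h]
    let ?f = "\<lambda>\<omega>. (u \<bullet> Z ?h \<omega>, v \<bullet> Z ?h \<omega>)"
    let ?\<mu> = "distr M borel ?f"
    have f: "?f \<in> borel_measurable M" unfolding borel_prod[symmetric] by measurable
    have int: "(\<integral>\<^sup>+z. ennreal (exp (a * fst z + b * snd z)) \<partial>?\<mu>) \<le> 1"
      if "exp_moment M Z 1 (a *\<^sub>R u + b *\<^sub>R v) \<le> 1" for a b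
    proof -
      have "(\<integral>\<^sup>+z. ennreal (exp (a * fst z + b * snd z)) \<partial>?\<mu>) = exp_moment M Z ?h (a *\<^sub>R u + b *\<^sub>R v)"
        using f unfolding exp_moment_def
        by (subst nn_integral_distr) (auto simp: inner_add_left borel_prod[symmetric])
      also have "\<dots> \<le> 1" by (rule exp_moment_dyadic_le_1[OF levy that])
      finally show ?thesis .
    qed
    have "emeasure M (E n) \<le> ennreal (exp (- (r * x + s * y)))"
      unfolding E_def emeasure_exceeds_on_grid_both[OF zero_le_divide_1_iff[THEN iffD2, OF zero_le_power[OF zero_le_numeral]]]
      using f int[of 1 0] int[of 0 1] int[OF uv] u v
      by (intro reflect_pair_joint_tail prob_space_distr r s) auto
    then show ?thesis by (simp add: emeasure_eq_measure)
  qed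
  have "(\<lambda>n. measure M (E n)) \<longlonglongrightarrow> measure M (\<Union>n. E n)"
    using E_sets inc by (intro finite_Lim_measure_incseq) auto
  then have "measure M (\<Union>n. E n) \<le> exp (- (r * x + s * y))"
    using le by (intro LIMSEQ_le_const2) auto
  then show ?thesis unfolding Un .
qed

text \<open>The skeleton at integer times already exceeds levels often enough. Its contraction at half the
  exponent is strict midpoint convexity between \<open>u\<close> and \<open>0\<close>.\<close>

lemma exceeds_constant_pos:
  assumes u: "exp_moment M Z 1 u = 1"
    and eps: "0 < \<epsilon>" "exp_moment M Z 1 ((1 + \<epsilon>) *\<^sub>R u) < \<infinity>"
    and nz: "\<not> (AE \<omega> in M. \<forall>t\<ge>0. u \<bullet> Z t \<omega> = 0)"
    and lim: "((\<lambda>x. exp x * measure M {\<omega> \<in> space M. exceeds Z u x \<omega>}) \<longlongrightarrow> C) at_top"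
  shows "0 < C"
proof -
  interpret prob_space M by (rule levy_prob_space[OF levy])
  note [measurable] = levy_measurable[OF levy, of 1]
  let ?\<mu> = "distr M borel (\<lambda>\<omega>. u \<bullet> Z 1 \<omega>)"
  have int: "(\<integral>\<^sup>+x. ennreal (exp (a * x)) \<partial>?\<mu>) = exp_moment M Z 1 (a *\<^sub>R u)" for a
    unfolding exp_moment_def by (subst nn_integral_distr) auto
  have "exp_moment M Z 1 0 = 1" by (simp add: exp_moment_def emeasure_space_1)
  from exp_moment_midpoint_less_1[OF levy u this] nz
  have half: "exp_moment M Z 1 ((1/2) *\<^sub>R u) < 1" by simp
  obtain \<eta> where \<eta>: "0 < \<eta>" "\<And>x0. \<exists>x\<ge>x0. \<exists>n.
      ennreal (\<eta> * exp (- x)) < emeasure (driven_law reflect 0 ?\<mu> n) {x<..}"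
    using driven_reflect_tail_lower_bound[of ?\<mu> \<epsilon>] int[of 1] int[of "1/2"] int[of "1 + \<epsilon>"] u half eps
    by (auto simp: prob_space_distr)
  have "\<eta> \<le> C"
  proof (rule ccontr)
    assume "\<not> \<eta> \<le> C"
    then have "eventually (\<lambda>x. exp x * measure M {\<omega> \<in> space M. exceeds Z u x \<omega>} < \<eta>) at_top"
      using order_tendstoD(2)[OF lim, of \<eta>] by simp
    then obtain x0 where x0: "\<And>x. x0 \<le> x \<Longrightarrow> exp x * measure M {\<omega> \<in> space M. exceeds Z u x \<omega>} < \<eta>"
      by (auto simp: eventually_at_top_linorder)
    obtain x n where x: "x0 \<le> x" "ennreal (\<eta> * exp (- x)) < emeasure (driven_law reflect 0 ?\<mu> n) {x<..}"
      using \<eta>(2) by blast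
    have "ennreal (\<eta> * exp (- x)) < emeasure M {\<omega> \<in> space M. exceeds_on_grid Z 1 n u x \<omega>}"
      using x(2) by (simp add: emeasure_exceeds_on_grid)
    also have "\<dots> \<le> emeasure M {\<omega> \<in> space M. exceeds Z u x \<omega>}"
      by (intro emeasure_mono exceeds_measurable) (auto intro: exceeds_on_grid_imp_exceeds[of 1])
    finally have "\<eta> * exp (- x) < measure M {\<omega> \<in> space M. exceeds Z u x \<omega>}"
      using \<eta>(1) by (simp add: emeasure_eq_measure ennreal_less_iff)
    then have "exp x * (\<eta> * exp (- x)) < exp x * measure M {\<omega> \<in> space M. exceeds Z u x \<omega>}"
      by simp
    moreover have "exp x * (\<eta> * exp (- x)) = \<eta>" by (simp add: exp_minus)
    ultimately show False using x0[OF x(1)] by simp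
  qed
  with \<eta>(1) show ?thesis by simp
qed

text \<open>The moment is below \<open>1\<close> at the midpoint of \<open>u\<close> and \<open>v\<close> and finite at \<open>(1 + \<epsilon>) u\<close>. By
  convexity it stays at most \<open>1\<close> after a small move from the former point towards the latter. Along
  this move the coefficient sum \<open>r + s\<close> increases from \<open>1\<close> towards \<open>1 + \<epsilon>\<close>.\<close>

lemma ex_exponent_beyond_segment:
  assumes u: "exp_moment M Z 1 u = 1" and v: "exp_moment M Z 1 v = 1"
    and eps: "0 < \<epsilon>" "exp_moment M Z 1 ((1 + \<epsilon>) *\<^sub>R u) < \<infinity>"
    and neq: "\<not> (AE \<omega> in M. \<forall>t\<ge>0. u \<bullet> Z t \<omega> = v \<bullet> Z t \<omega>)"
  obtains r s where "0 \<le> r" "r \<le> 1" "0 \<le> s" "s \<le> 1" "1 < r + s"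
    "exp_moment M Z 1 (r *\<^sub>R u + s *\<^sub>R v) \<le> 1"
proof -
  let ?m = "(1/2) *\<^sub>R (u + v)"
  define m where "m = enn2real (exp_moment M Z 1 ?m)"
  define A where "A = enn2real (exp_moment M Z 1 ((1 + \<epsilon>) *\<^sub>R u))"
  have mid: "exp_moment M Z 1 ?m < 1"
    by (rule exp_moment_midpoint_less_1[OF levy u v neq])
  then have m: "exp_moment M Z 1 ?m = ennreal m" "0 \<le> m"
    unfolding m_def by (auto simp: less_top[symmetric] top_unique intro!: ennreal_enn2real[symmetric])
  then have m1: "m < 1" using mid by (simp add: ennreal_less_one_iff)
  have A: "exp_moment M Z 1 ((1 + \<epsilon>) *\<^sub>R u) = ennreal A" "0 \<le> A"
    using eps by (auto simp: A_def)
  \<comment> \<open>The fraction of the way to move: the first bound keeps \<open>r \<le> 1\<close>, the second keeps the moment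
    at most \<open>1\<close>.\<close>
  define l where "l = min (1 / (1 + 2 * \<epsilon>)) ((1 - m) / (A + 1))"
  have l: "0 < l" "l \<le> 1 / (1 + 2 * \<epsilon>)" "l \<le> (1 - m) / (A + 1)"
    using m1 A eps by (auto simp: l_def)
  have l2: "l * (1 + 2 * \<epsilon>) \<le> 1" using l(2) eps by (simp add: pos_le_divide_eq)
  have l3: "l * (A + 1) \<le> 1 - m" using l(3) A by (simp add: pos_le_divide_eq)
  have le: "0 < l * \<epsilon>" using l eps by simp
  have l1: "l \<le> 1" using l2 le by (simp add: algebra_simps)
  define r where "r = (1 - l) / 2 + l * (1 + \<epsilon>)"
  define s where "s = (1 - l) / 2"
  have eq: "r *\<^sub>R u + s *\<^sub>R v = (1 - l) *\<^sub>R ?m + l *\<^sub>R ((1 + \<epsilon>) *\<^sub>R u)"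
    by (simp add: r_def s_def algebra_simps)
  have "exp_moment M Z 1 (r *\<^sub>R u + s *\<^sub>R v) \<le> ennreal (1 - l) * ennreal m + ennreal l * ennreal A"
    unfolding eq m(1)[symmetric] A(1)[symmetric] using l l1 by (intro exp_moment_convex[OF levy]) auto
  also have "\<dots> = ennreal ((1 - l) * m + l * A)"
    using l l1 m A by (simp add: ennreal_mult ennreal_plus)
  also have "\<dots> \<le> ennreal 1"
  proof (rule ennreal_leI)
    have "(1 - l) * m \<le> 1 * m" using l m by (intro mult_right_mono) auto
    moreover have "l * A \<le> 1 - m" using l3 l by (simp add: algebra_simps)
    ultimately show "(1 - l) * m + l * A \<le> 1" by simp
  qed
  finally have "exp_moment M Z 1 (r *\<^sub>R u + s *\<^sub>R v) \<le> 1" by simp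
  moreover have "0 \<le> r" "r \<le> 1" "0 \<le> s" "s \<le> 1" "1 < r + s"
    using l l1 l2 le eps by (auto simp: r_def s_def field_simps)
  ultimately show thesis using that by blast
qed

end

section \<open>Ruin probabilities\<close>

lemma ruin_time_finite_iff: "ruin_time Y x \<omega> < \<infinity> \<longleftrightarrow> (\<exists>t\<ge>0. x + Y t \<omega> < 0)"
  unfolding ruin_time_def Inf_less_iff by auto

lemma exp_moment_of_cumulant_eq_0:
  assumes "prob_space M" and Z: "Z 1 \<in> borel_measurable M" and "cumulant M Z \<theta> = 0"
  shows "exp_moment M Z 1 \<theta> = 1"
proof -
  interpret prob_space M by fact
  note [measurable] = Z
  let ?m = "exp_moment M Z 1 \<theta>"
  have m: "(\<integral>\<^sup>+ \<omega>. ennreal (exp (fst \<theta> * fst (Z 1 \<omega>) + snd \<theta> * snd (Z 1 \<omega>))) \<partial>M) = ?m"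
    by (simp add: exp_moment_def inner_prod_def)
  have fin: "?m \<noteq> \<infinity>" and ln: "ln (enn2real ?m) = 0"
    using assms(3) unfolding cumulant_def m Let_def by (auto split: if_splits)
  \<comment> \<open>\<open>ln 0 = 0\<close>, so a vanishing moment has to be excluded.\<close>
  have "?m \<noteq> 0"
  proof
    assume "?m = 0"
    then have "AE \<omega> in M. ennreal (exp (\<theta> \<bullet> Z 1 \<omega>)) = 0"
      unfolding exp_moment_def by (subst (asm) nn_integral_0_iff_AE) auto
    then show False by (simp add: ennreal_eq_0_iff)
  qed
  then have "0 < enn2real ?m" using fin by (simp add: enn2real_positive_iff zero_less_iff_neq_zero top.not_eq_extremum)
  then have "enn2real ?m = 1" using ln by simp
  then show ?thesis using fin by (metis ennreal_1 ennreal_enn2real infinity_ennreal_def less_top)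
qed

lemma exp_moment_beyond_interior:
  assumes "\<theta> \<in> interior (cumulant_domain M Z)"
  obtains \<epsilon> where "0 < \<epsilon>" "exp_moment M Z 1 ((1 + \<epsilon>) *\<^sub>R \<theta>) < \<infinity>"
proof -
  obtain e where e: "0 < e" "ball \<theta> e \<subseteq> cumulant_domain M Z"
    using assms by (auto simp: mem_interior)
  define \<epsilon> where "\<epsilon> = e / (2 * (norm \<theta> + 1))"
  have n: "0 < norm \<theta> + 1" by (simp add: add_nonneg_pos)
  have \<epsilon>: "0 < \<epsilon>" using e n by (simp add: \<epsilon>_def)
  have "\<epsilon> * norm \<theta> < e"
  proof -
    have "\<epsilon> * norm \<theta> \<le> \<epsilon> * (norm \<theta> + 1)" using \<epsilon> by (intro mult_left_mono) auto
    also have "\<dots> = e / 2" using n by (simp only: \<epsilon>_def) (simp add: divide_eq_eq)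
    finally show ?thesis using e by simp
  qed
  then have "(1 + \<epsilon>) *\<^sub>R \<theta> \<in> ball \<theta> e"
    using \<epsilon> by (simp add: dist_norm scaleR_add_left)
  then have "cumulant M Z ((1 + \<epsilon>) *\<^sub>R \<theta>) < \<infinity>"
    using e by (auto simp: cumulant_domain_def)
  then have "exp_moment M Z 1 ((1 + \<epsilon>) *\<^sub>R \<theta>) \<noteq> \<infinity>"
    unfolding cumulant_def exp_moment_def Let_def by (auto simp: inner_prod_def split: if_splits)
  then show thesis using \<epsilon> by (intro that) (auto simp: less_top)
qed

lemma monotone_paths_if_AE_zero:
  assumes "AE \<omega> in M. \<forall>t\<ge>0. Y t \<omega> = 0"
  shows "has_monotone_paths M Y"
proof -
  have "AE \<omega> in M. mono_on {0..} (\<lambda>t. Y t \<omega>)"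
    using assms by eventually_elim (auto simp: mono_on_def)
  then show ?thesis by (simp add: has_monotone_paths_def)
qed

theorem theorem3:
  fixes M :: "'a measure" and Z :: "real \<Rightarrow> 'a \<Rightarrow> real \<times> real"
    and \<gamma>1 \<gamma>2 a C1 C2 :: real
  defines "Z1 \<equiv> \<lambda>t \<omega>. fst (Z t \<omega>)" and "Z2 \<equiv> \<lambda>t \<omega>. snd (Z t \<omega>)"
  assumes "levy_process M Z"
    and "\<not> has_monotone_paths M Z1" and "\<not> has_monotone_paths M Z2"
    and "\<not> has_constant_ratio M Z1 Z2"
    and "AE \<omega> in M. filterlim (\<lambda>t. Z1 t \<omega>) at_top at_top"
    and "AE \<omega> in M. filterlim (\<lambda>t. Z2 t \<omega>) at_top at_top"
    and "\<gamma>1 > 0" and "\<gamma>2 > 0"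
    and "cumulant M Z (- \<gamma>1, 0) = 0" and "cumulant M Z (0, - \<gamma>2) = 0"
    and "(- \<gamma>1, 0) \<in> interior (cumulant_domain M Z)"
    and "(0, - \<gamma>2) \<in> interior (cumulant_domain M Z)"
    and "a > 0"
    and "((\<lambda>x. exp (\<gamma>1 * x) * ruin_prob M Z1 x) \<longlongrightarrow> C1) at_top"
    and "((\<lambda>x. exp (\<gamma>2 * x) * ruin_prob M Z2 x) \<longlongrightarrow> C2) at_top"
  shows "C1 > 0 \<and> C2 > 0 \<and>
     (\<lambda>K. ruin_prob_or M Z (a * K) K)
       \<sim>[at_top] (\<lambda>K. C2 * exp (- \<gamma>2 * K) + C1 * exp (- \<gamma>1 * a * K)) \<and>
     (\<lambda>K. ruin_prob_and M Z (a * K) K)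
       \<in> o[at_top](\<lambda>K. C2 * exp (- \<gamma>2 * K) + C1 * exp (- \<gamma>1 * a * K))"
proof -
  note levy = assms(3) and \<gamma> = \<open>\<gamma>1 > 0\<close> \<open>\<gamma>2 > 0\<close> and a = \<open>a > 0\<close>
  note lim1 = assms(16) and lim2 = assms(17)
  interpret prob_space M by (rule levy_prob_space[OF levy])
  have Z_1: "Z 1 \<in> borel_measurable M" by (rule levy_measurable[OF levy]) simp
  \<comment> \<open>In these directions ruin is exceedance of a level, with decay rate normalised to \<open>1\<close>.\<close>
  define u :: "real \<times> real" where "u = (- \<gamma>1, 0)"
  define v :: "real \<times> real" where "v = (0, - \<gamma>2)"
  have uZ: "u \<bullet> Z t \<omega> = - \<gamma>1 * Z1 t \<omega>" and vZ: "v \<bullet> Z t \<omega> = - \<gamma>2 * Z2 t \<omega>" for t \<omega>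
    by (auto simp: u_def v_def Z1_def Z2_def inner_prod_def)
  have u1: "exp_moment M Z 1 u = 1" and v1: "exp_moment M Z 1 v = 1"
    unfolding u_def v_def using assms Z_1 prob_space_axioms
    by (auto intro!: exp_moment_of_cumulant_eq_0)
  obtain \<epsilon>u where \<epsilon>u: "0 < \<epsilon>u" "exp_moment M Z 1 ((1 + \<epsilon>u) *\<^sub>R u) < \<infinity>"
    using exp_moment_beyond_interior assms unfolding u_def by metis
  obtain \<epsilon>v where \<epsilon>v: "0 < \<epsilon>v" "exp_moment M Z 1 ((1 + \<epsilon>v) *\<^sub>R v) < \<infinity>"
    using exp_moment_beyond_interior assms unfolding v_def by metis
  have u_nz: "\<not> (AE \<omega> in M. \<forall>t\<ge>0. u \<bullet> Z t \<omega> = 0)"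
    using \<open>\<not> has_monotone_paths M Z1\<close> monotone_paths_if_AE_zero[where M = M and Y = Z1] \<gamma> by (auto simp: uZ)
  have v_nz: "\<not> (AE \<omega> in M. \<forall>t\<ge>0. v \<bullet> Z t \<omega> = 0)"
    using \<open>\<not> has_monotone_paths M Z2\<close> monotone_paths_if_AE_zero[where M = M and Y = Z2] \<gamma> by (auto simp: vZ)
  have uv_neq: "\<not> (AE \<omega> in M. \<forall>t\<ge>0. u \<bullet> Z t \<omega> = v \<bullet> Z t \<omega>)"
  proof
    assume "AE \<omega> in M. \<forall>t\<ge>0. u \<bullet> Z t \<omega> = v \<bullet> Z t \<omega>"
    then have "AE \<omega> in M. \<forall>t\<ge>0. Z1 t \<omega> = (\<gamma>2 / \<gamma>1) * Z2 t \<omega>"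
      by eventually_elim (use \<gamma> in \<open>auto simp: uZ vZ field_simps\<close>)
    with \<open>\<not> has_constant_ratio M Z1 Z2\<close> show False
      unfolding has_constant_ratio_def by blast
  qed
  define R1 where "R1 x = {\<omega> \<in> space M. exceeds Z u (\<gamma>1 * x) \<omega>}" for x
  define R2 where "R2 x = {\<omega> \<in> space M. exceeds Z v (\<gamma>2 * x) \<omega>}" for x
  have R_sets: "R1 x \<in> sets M" "R2 x \<in> sets M" for x
    unfolding R1_def R2_def by (intro exceeds_measurable[OF levy])+
  have ruin1: "exceeds Z u (\<gamma>1 * x) \<omega> \<longleftrightarrow> (\<exists>t\<ge>0. x + Z1 t \<omega> < 0)" for x \<omega>
  proof -
    have "\<gamma>1 * x < - \<gamma>1 * Z1 t \<omega> \<longleftrightarrow> \<gamma>1 * (x + Z1 t \<omega>) < 0" for t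
      by (simp add: distrib_left) linarith
    then show ?thesis unfolding exceeds_def uZ using \<gamma> by (simp add: mult_less_0_iff)
  qed
  have ruin2: "exceeds Z v (\<gamma>2 * x) \<omega> \<longleftrightarrow> (\<exists>t\<ge>0. x + Z2 t \<omega> < 0)" for x \<omega>
  proof -
    have "\<gamma>2 * x < - \<gamma>2 * Z2 t \<omega> \<longleftrightarrow> \<gamma>2 * (x + Z2 t \<omega>) < 0" for t
      by (simp add: distrib_left) linarith
    then show ?thesis unfolding exceeds_def vZ using \<gamma> by (simp add: mult_less_0_iff)
  qed
  have psi1: "ruin_prob M Z1 x = prob (R1 x)" and psi2: "ruin_prob M Z2 x = prob (R2 x)" for x
    unfolding ruin_prob_def ruin_time_finite_iff R1_def R2_def ruin1 ruin2 by simp_all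
  have psi_and: "ruin_prob_and M Z x y = prob (R1 x \<inter> R2 y)" for x y
    unfolding ruin_prob_and_def ruin_time_finite_iff R1_def R2_def ruin1 ruin2 Z1_def Z2_def
    by (intro arg_cong[where f = prob]) auto
  have psi_or: "ruin_prob_or M Z x y = prob (R1 x \<union> R2 y)" for x y
    unfolding ruin_prob_or_def R1_def R2_def ruin1 ruin2 Z1_def Z2_def
    by (intro arg_cong[where f = prob]) auto
  have C1: "0 < C1"
  proof (rule exceeds_constant_pos[OF levy u1 \<epsilon>u u_nz])
    have "filterlim (\<lambda>y. y / \<gamma>1) at_top at_top"
      using \<gamma> by (intro filterlim_at_top_mult_tendsto_pos[OF tendsto_const]
          filterlim_ident | simp add: divide_inverse)+
    from filterlim_compose[OF lim1 this]
    show "((\<lambda>y. exp y * prob {\<omega> \<in> space M. exceeds Z u y \<omega>}) \<longlongrightarrow> C1) at_top"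
      using \<gamma> by (simp add: psi1 R1_def)
  qed
  have C2: "0 < C2"
  proof (rule exceeds_constant_pos[OF levy v1 \<epsilon>v v_nz])
    have "filterlim (\<lambda>y. y / \<gamma>2) at_top at_top"
      using \<gamma> by (intro filterlim_at_top_mult_tendsto_pos[OF tendsto_const]
          filterlim_ident | simp add: divide_inverse)+
    from filterlim_compose[OF lim2 this]
    show "((\<lambda>y. exp y * prob {\<omega> \<in> space M. exceeds Z v y \<omega>}) \<longlongrightarrow> C2) at_top"
      using \<gamma> by (simp add: psi2 R2_def)
  qed
  let ?h = "\<lambda>K. C2 * exp (- \<gamma>2 * K) + C1 * exp (- \<gamma>1 * a * K)"
  obtain r s where rs: "0 \<le> r" "r \<le> 1" "0 \<le> s" "s \<le> 1" "1 < r + s"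
    "exp_moment M Z 1 (r *\<^sub>R u + s *\<^sub>R v) \<le> 1"
    using ex_exponent_beyond_segment[OF levy u1 v1 \<epsilon>u uv_neq] by blast
  have and_bound: "ruin_prob_and M Z (a * K) K \<le> exp (- (r * (\<gamma>1 * (a * K)) + s * (\<gamma>2 * K)))" for K
  proof -
    have "R1 (a * K) \<inter> R2 K = {\<omega> \<in> space M. exceeds Z u (\<gamma>1 * (a * K)) \<omega> \<and> exceeds Z v (\<gamma>2 * K) \<omega>}"
      by (auto simp: R1_def R2_def)
    then show ?thesis unfolding psi_and
      using exceeds_both_bound[OF levy _ _ rs(6) rs(1-4)] u1 v1 by simp
  qed
  have small: "(\<lambda>K. ruin_prob_and M Z (a * K) K) \<in> o[at_top](?h)"
  proof -
    \<comment> \<open>Both marginal exponents are at least \<open>\<beta>\<close>, so the joint exponent is at least \<open>(r + s) \<beta>\<close>, which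
      exceeds \<open>\<beta>\<close>, the decay rate of the sum, by \<open>\<delta>\<close>.\<close>
    define \<beta> where "\<beta> = min (\<gamma>1 * a) \<gamma>2"
    define c where "c = min C1 C2"
    define \<delta> where "\<delta> = (r + s - 1) * \<beta>"
    have \<beta>: "0 < \<beta>" and c: "0 < c" using \<gamma> a C1 C2 by (auto simp: \<beta>_def c_def)
    have \<delta>: "0 < \<delta>" using \<beta> rs by (simp add: \<delta>_def)
    have h_ge: "c * exp (- \<beta> * K) \<le> ?h K" for K
    proof (cases "\<gamma>1 * a \<le> \<gamma>2")
      case True
      have "c * exp (- \<beta> * K) \<le> C1 * exp (- \<gamma>1 * a * K)"
        using True by (simp add: \<beta>_def c_def)
      then show ?thesis using C2 by (simp add: add_increasing)
    next
      case False
      have "c * exp (- \<beta> * K) \<le> C2 * exp (- \<gamma>2 * K)"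
        using False by (simp add: \<beta>_def c_def)
      then show ?thesis using C1 by (simp add: add_increasing2)
    qed
    have ratio: "norm (ruin_prob_and M Z (a * K) K / ?h K) \<le> (1 / c) * exp (- \<delta> * K)" if "0 \<le> K" for K
    proof -
      have "0 < c * exp (- \<beta> * K)" using c by simp
      then have h_pos: "0 < ?h K" using h_ge[of K] by linarith
      have "(\<beta> + \<delta>) * K \<le> r * (\<gamma>1 * (a * K)) + s * (\<gamma>2 * K)"
      proof -
        have "r * \<beta> \<le> r * (\<gamma>1 * a)" "s * \<beta> \<le> s * \<gamma>2"
          using rs by (auto simp: \<beta>_def intro!: mult_left_mono)
        then have "\<beta> + \<delta> \<le> r * (\<gamma>1 * a) + s * \<gamma>2" by (simp add: \<delta>_def algebra_simps)
        from mult_right_mono[OF this that] show ?thesis by (simp add: algebra_simps)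
      qed
      then have "exp (- (r * (\<gamma>1 * (a * K)) + s * (\<gamma>2 * K))) \<le> exp (- (\<beta> + \<delta>) * K)"
        unfolding exp_le_cancel_iff minus_mult_left[symmetric] neg_le_iff_le .
      with and_bound[of K] have "ruin_prob_and M Z (a * K) K \<le> exp (- (\<beta> + \<delta>) * K)"
        by (rule order_trans)
      also have "\<dots> = (1 / c * exp (- \<delta> * K)) * (c * exp (- \<beta> * K))"
        using c by (simp add: exp_add[symmetric] algebra_simps)
      also have "\<dots> \<le> (1 / c * exp (- \<delta> * K)) * ?h K"
        using c h_ge[of K] by (intro mult_left_mono) auto
      finally have "ruin_prob_and M Z (a * K) K / ?h K \<le> 1 / c * exp (- \<delta> * K)"
        using h_pos by (simp only: pos_divide_le_eq)
      moreover have "0 \<le> ruin_prob_and M Z (a * K) K" by (simp add: psi_and)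
      ultimately show ?thesis using h_pos by (simp only: real_norm_def abs_of_nonneg divide_nonneg_pos)
    qed
    have "((\<lambda>K. (1 / c) * exp (- \<delta> * K)) \<longlongrightarrow> 0) at_top"
    proof -
      have "filterlim (\<lambda>K. \<delta> * K) at_top at_top"
        using \<delta> by (intro filterlim_tendsto_pos_mult_at_top[OF tendsto_const _ filterlim_ident])
      then have "((\<lambda>K. exp (- (\<delta> * K))) \<longlongrightarrow> 0) at_top"
        by (intro filterlim_compose[OF exp_at_bot] filterlim_uminus_at_bot[THEN iffD2]) simp
      from tendsto_mult_right_zero[OF this, of "1 / c"] show ?thesis by simp
    qed
    then have "((\<lambda>K. ruin_prob_and M Z (a * K) K / ?h K) \<longlongrightarrow> 0) at_top"
      by (rule Lim_null_comparison[rotated]) (use ratio in \<open>auto simp: eventually_at_top_linorder\<close>)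
    moreover have "?h K \<noteq> 0" for K
      using h_ge[of K] c by (smt (verit) exp_gt_zero mult_pos_pos)
    ultimately show ?thesis by (intro smalloI_tendsto) auto
  qed
  have sim1: "(\<lambda>K. ruin_prob M Z1 (a * K)) \<sim>[at_top] (\<lambda>K. C1 * exp (- \<gamma>1 * a * K))"
  proof (rule asymp_equivI')
    have "filterlim (\<lambda>K. a * K) at_top at_top"
      using a by (intro filterlim_tendsto_pos_mult_at_top[OF tendsto_const _ filterlim_ident])
    from tendsto_divide[OF filterlim_compose[OF lim1 this] tendsto_const, of C1] C1
    show "((\<lambda>K. ruin_prob M Z1 (a * K) / (C1 * exp (- \<gamma>1 * a * K))) \<longlongrightarrow> 1) at_top"
      by (simp add: exp_minus field_simps)
  qed
  have sim2: "(\<lambda>K. ruin_prob M Z2 K) \<sim>[at_top] (\<lambda>K. C2 * exp (- \<gamma>2 * K))"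
  proof (rule asymp_equivI')
    from tendsto_divide[OF lim2 tendsto_const, of C2] C2
    show "((\<lambda>K. ruin_prob M Z2 K / (C2 * exp (- \<gamma>2 * K))) \<longlongrightarrow> 1) at_top"
      by (simp add: exp_minus field_simps)
  qed
  have or_eq: "ruin_prob_or M Z (a * K) K =
      (ruin_prob M Z2 K + ruin_prob M Z1 (a * K)) - ruin_prob_and M Z (a * K) K" for K
    using R_sets by (simp add: psi1 psi2 psi_and psi_or measure_Un3 fmeasurable_eq_sets)
  have diff1: "(\<lambda>K. ruin_prob M Z1 (a * K) - C1 * exp (- \<gamma>1 * a * K)) \<in> o[at_top](?h)"
    using C1 C2 by (intro landau_o.small_big_trans[OF asymp_equiv_imp_diff_smallo[OF sim1]]
        bigoI[where c = 1]) auto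
  have diff2: "(\<lambda>K. ruin_prob M Z2 K - C2 * exp (- \<gamma>2 * K)) \<in> o[at_top](?h)"
    using C1 C2 by (intro landau_o.small_big_trans[OF asymp_equiv_imp_diff_smallo[OF sim2]]
        bigoI[where c = 1]) auto
  have "(\<lambda>K. (ruin_prob M Z1 (a * K) - C1 * exp (- \<gamma>1 * a * K)) +
      (ruin_prob M Z2 K - C2 * exp (- \<gamma>2 * K)) - ruin_prob_and M Z (a * K) K) \<in> o[at_top](?h)"
    by (rule sum_in_smallo(2)[OF sum_in_smallo(1)[OF diff1 diff2] small])
  from asymp_equiv_add_right[OF this, of ?h]
  have "(\<lambda>K. ruin_prob_or M Z (a * K) K) \<sim>[at_top] ?h"
    unfolding or_eq by (simp add: algebra_simps)
  with small C1 C2 show ?thesis by simp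
qed

end
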